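(* Let $1\le r\le n$ and let $A\in\mathbb{C}_r^{n\times n}$, $B\in\mathbb{C}_n^{n\times n}$ be normal matrices whose nonzero eigenvalues, listed with multiplicity, are $\lambda_1,\dots,\lambda_r$ and $\widehat\lambda_1,\dots,\widehat\lambda_n$, respectively. Put $\widehat F_{r,n}:=\sum_{j=1}^r|\lambda_j|^2+\sum_{j=1}^n|\widehat\lambda_j|^2$. Then $$\big\||A|-|B|\big\|_F\le\sqrt{\max_{\sigma\in S_r([n])}\frac{\widehat F_{r,n}-2\sum_{j=1}^r|\widehat\lambda_{\sigma(j)}||\lambda_j|}{\widehat F_{r,n}-2\sum_{j=1}^r\Re\big(\widehat\lambda_{\sigma(j)}\overline{\lambda_j}\big)}}\;\|A-B\|_F .$$ Moreover the coefficient of $\|A-B\|_F$ is optimal: for given $n$ and given nonzero $\lambda_1,\dots,\lambda_r$, $\widehat\lambda_1,\dots,\widehat\lambda_n$, it cannot be replaced by any smaller nonnegative number so that the inequality still holds for all $n\times n$ normal matrices $A,B$ of ranks $r$ and $n$ with these nonzero eigenvalues.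
   Context: $\mathbb{C}^{n\times n}_r$ denotes the set of complex $n\times n$ matrices of rank $r$; $\|\cdot\|_F$ is the Frobenius norm; $|A|:=(A^*A)^{1/2}$; $[n]=\{1,\dots,n\}$; $S_r([n])$ is the set of ordered arrangements $\sigma=(\sigma(1),\dots,\sigma(r))$ of $r$ distinct elements of $[n]$; $\Re$ denotes real part. A quotient of the form $0/0$ in the maximum is read as $0$. *)

theory Defs
  imports
    "Jordan_Normal_Form.Schur_Decomposition"
    "Jordan_Normal_Form.DL_Rank"
    "HOL-Library.FuncSet"
begin

definition frobenius_norm :: "complex mat \<Rightarrow> real" where
  "frobenius_norm A = sqrt (\<Sum>i<dim_row A. \<Sum>j<dim_col A. (cmod (A $$ (i, j)))\<^sup>2)"

definition normal_mat :: "complex mat \<Rightarrow> bool" where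
  "normal_mat A \<longleftrightarrow> square_mat A \<and> mat_adjoint A * A = A * mat_adjoint A"

definition positive_semidefinite :: "complex mat \<Rightarrow> bool" where
  "positive_semidefinite P \<longleftrightarrow> square_mat P \<and> mat_adjoint P = P \<and>
     (\<forall>v \<in> carrier_vec (dim_row P). 0 \<le> Re ((P *\<^sub>v v) \<bullet>c v))"

text \<open>The absolute value \<open>(A\<^sup>* A)\<^bsup>1/2\<^esup>\<close>, where the square root of a positive semidefinite matrix
  is its unique positive semidefinite square root.\<close>

definition mat_abs :: "complex mat \<Rightarrow> complex mat" where
  "mat_abs A = (THE P. positive_semidefinite P \<and> P * P = mat_adjoint A * A)"

text \<open>The list \<open>l 1, \<dots>, l k\<close> consists of the nonzero eigenvalues of \<open>A\<close>, each repeated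
  according to its algebraic multiplicity (for normal matrices this is also the geometric one).\<close>

definition lists_nonzero_eigenvalues :: "complex mat \<Rightarrow> nat \<Rightarrow> (nat \<Rightarrow> complex) \<Rightarrow> bool" where
  "lists_nonzero_eigenvalues A k l \<longleftrightarrow>
     filter_mset (\<lambda>z. z \<noteq> 0) (proots (char_poly A)) = image_mset l (mset_set {1..k})"

definition normal_mats_with :: "nat \<Rightarrow> nat \<Rightarrow> (nat \<Rightarrow> complex) \<Rightarrow> complex mat set" where
  "normal_mats_with n k l =
     {A \<in> carrier_mat n n. normal_mat A \<and> vec_space.rank n A = k \<and> lists_nonzero_eigenvalues A k l}"

text \<open>Ordered arrangements of \<open>r\<close> distinct elements of \<open>{1..n}\<close>, as injective functions on \<open>{1..r}\<close>;
  extensionality makes each arrangement a single function.\<close>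

definition arrangements :: "nat \<Rightarrow> nat \<Rightarrow> (nat \<Rightarrow> nat) set" where
  "arrangements r n = {\<sigma> \<in> {1..r} \<rightarrow>\<^sub>E {1..n}. inj_on \<sigma> {1..r}}"

definition F_hat :: "nat \<Rightarrow> nat \<Rightarrow> (nat \<Rightarrow> complex) \<Rightarrow> (nat \<Rightarrow> complex) \<Rightarrow> real" where
  "F_hat r n lam lamh = (\<Sum>j=1..r. (cmod (lam j))\<^sup>2) + (\<Sum>j=1..n. (cmod (lamh j))\<^sup>2)"

text \<open>The denominator is \<open>\<Sum> \<bar>lam j - lamh (\<sigma> j)\<bar>\<^sup>2\<close> over \<open>j \<le> r\<close> plus the remaining \<open>\<bar>lamh k\<bar>\<^sup>2\<close>; if it
  vanishes then so does the numerator, and \<open>0 / 0 = 0\<close> is the intended value of the quotient.\<close>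

definition abs_coeff :: "nat \<Rightarrow> nat \<Rightarrow> (nat \<Rightarrow> complex) \<Rightarrow> (nat \<Rightarrow> complex) \<Rightarrow> real" where
  "abs_coeff r n lam lamh = sqrt (Max ((\<lambda>\<sigma>.
     (F_hat r n lam lamh - 2 * (\<Sum>j=1..r. cmod (lamh (\<sigma> j)) * cmod (lam j))) /
     (F_hat r n lam lamh - 2 * (\<Sum>j=1..r. Re (lamh (\<sigma> j) * cnj (lam j)))))
     ` arrangements r n))"

end

theory Submission
  imports Defs
begin

text \<open>
  Let \<open>a = (\<lambda>\<^sub>1, \<dots>, \<lambda>\<^sub>r, 0, \<dots>, 0)\<close> be the eigenvalues of \<open>A\<close> and \<open>b\<close> those of \<open>B\<close>. By the spectral theorem
  (\<open>normal_spectral_decomposition\<close>) \<open>A = U diag(a) U\<^sup>*\<close> and \<open>B = V diag(b) V\<^sup>*\<close> with unitary \<open>U\<close> and \<open>V\<close>. Put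
  \<open>W = U\<^sup>* V\<close>. Unitary invariance of the Frobenius norm gives (\<open>frobenius_norm_diff_diagonalised\<close>)

  \<open>\<parallel>A - B\<parallel>\<^sup>2 = \<Sum>\<^sub>i\<^sub>j \<bar>a\<^sub>i - b\<^sub>j\<bar>\<^sup>2 \<bar>W\<^sub>i\<^sub>j\<bar>\<^sup>2\<close>.

  The absolute values are diagonalised by the same unitary matrices (\<open>mat_abs_diagonalised\<close>), so the squared distance of
  \<open>\<bar>A\<bar>\<close> and \<open>\<bar>B\<bar>\<close> is \<open>\<Sum>\<^sub>i\<^sub>j (\<bar>a\<^sub>i\<bar> - \<bar>b\<^sub>j\<bar>)\<^sup>2 \<bar>W\<^sub>i\<^sub>j\<bar>\<^sup>2\<close> with the same weights. These weights form a doubly stochastic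
  matrix. With \<open>K\<close> the asserted coefficient, the inequality says that the linear functional with coefficients
  \<open>K\<^sup>2 \<bar>a\<^sub>i - b\<^sub>j\<bar>\<^sup>2 - (\<bar>a\<^sub>i\<bar> - \<bar>b\<^sub>j\<bar>)\<^sup>2\<close> is nonnegative at it. By Birkhoff's theorem
  (\<open>doubly_stochastic_functional_nonneg\<close>, derived from Hall's marriage theorem) it is enough to check this at
  permutation matrices. There the two sums of squares are exactly the numerator and the denominator of the
  quotient that belongs to an arrangement (\<open>assignment_cost\<close>), and \<open>K\<^sup>2\<close> is the largest of these quotients.

  For the optimality, let \<open>A\<close> and \<open>B\<close> be diagonal, with the eigenvalues of \<open>B\<close> permuted according to an arrangement
  at which the maximum is attained. If \<open>K > 0\<close> then \<open>A \<noteq> B\<close> and equality holds, so no smaller coefficient will do.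
\<close>

section \<open>Linear functionals on doubly stochastic matrices\<close>

text \<open>Halmos and Vaughan's induction on the number of indices. If some proper nonempty subfamily has
  exactly as many available values as indices, it can be matched on its own, and removing its values
  leaves Hall's condition intact for the rest. If there is none, every proper nonempty subfamily has a value
  to spare, so any one index may take any of its values.\<close>

lemma hall_marriage:
  fixes S :: "'a \<Rightarrow> 'b set"
  assumes "finite I" "\<And>i. i \<in> I \<Longrightarrow> finite (S i)"
    and "\<And>J. J \<subseteq> I \<Longrightarrow> card J \<le> card (\<Union>(S ` J))"
  shows "\<exists>f. inj_on f I \<and> (\<forall>i\<in>I. f i \<in> S i)"
  using assms
proof (induction "card I" arbitrary: I S rule: less_induct)
  case less
  note fI = less.prems(1) and fS = less.prems(2) and hall = less.prems(3)
  show ?case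
  proof (cases "I = {}")
    case True
    then show ?thesis by auto
  next
    case nonempty: False
    show ?thesis
    proof (cases "\<exists>J. J \<subset> I \<and> J \<noteq> {} \<and> card (\<Union>(S ` J)) = card J")
      case True
      then obtain J where J: "J \<subset> I" "J \<noteq> {}" "card (\<Union>(S ` J)) = card J" by blast
      let ?U = "\<Union>(S ` J)"
      have fJ: "finite J" using J(1) fI finite_subset by blast
      have "card J < card I" using J(1) fI psubset_card_mono by blast
      moreover have "card K \<le> card (\<Union>(S ` K))" if "K \<subseteq> J" for K
        using that J(1) by (intro hall) auto
      moreover have "\<And>i. i \<in> J \<Longrightarrow> finite (S i)" using fS J(1) by blast
      ultimately have "\<exists>f. inj_on f J \<and> (\<forall>i\<in>J. f i \<in> S i)"
        using less.hyps[of J S] fJ by blast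
      then obtain f where f: "inj_on f J" "\<forall>i\<in>J. f i \<in> S i" by blast
      have "card (I - J) < card I"
        using J fI by (intro psubset_card_mono) auto
      moreover have "card K \<le> card (\<Union>((\<lambda>i. S i - ?U) ` K))" if K: "K \<subseteq> I - J" for K
      proof -
        have fK: "finite K" using K fI finite_subset by blast
        have "card K + card J = card (K \<union> J)"
          using K fK fJ by (subst card_Un_disjoint) auto
        also have "\<dots> \<le> card (\<Union>(S ` (K \<union> J)))"
          using hall[of "K \<union> J"] K J by auto
        also have "\<Union>(S ` (K \<union> J)) = \<Union>((\<lambda>i. S i - ?U) ` K) \<union> ?U" by auto
        also have "card \<dots> \<le> card (\<Union>((\<lambda>i. S i - ?U) ` K)) + card ?U"
          by (rule card_Un_le)
        finally show ?thesis using J(3) by simp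
      qed
      moreover have "finite (I - J)" "\<And>i. i \<in> I - J \<Longrightarrow> finite (S i - ?U)" using fI fS by auto
      ultimately have "\<exists>g. inj_on g (I - J) \<and> (\<forall>i\<in>I - J. g i \<in> S i - ?U)"
        using less.hyps[of "I - J" "\<lambda>i. S i - ?U"] by blast
      then obtain g where g: "inj_on g (I - J)" "\<forall>i\<in>I - J. g i \<in> S i - ?U" by blast
      let ?h = "\<lambda>i. if i \<in> J then f i else g i"
      have "inj_on ?h I"
      proof (rule inj_onI)
        fix x y assume xy: "x \<in> I" "y \<in> I" "?h x = ?h y"
        show "x = y"
        proof (cases "x \<in> J"; cases "y \<in> J")
          assume "x \<in> J" "y \<in> J"
          then show ?thesis using xy f(1) by (simp add: inj_on_eq_iff)
        next
          assume "x \<in> J" "y \<notin> J"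
          then have "f x \<in> ?U" "g y \<notin> ?U" using xy(1,2) f(2) bspec[OF g(2), of y] by auto
          then show ?thesis using xy(3) \<open>x \<in> J\<close> \<open>y \<notin> J\<close> by simp
        next
          assume "x \<notin> J" "y \<in> J"
          then have "f y \<in> ?U" "g x \<notin> ?U" using xy(1,2) f(2) bspec[OF g(2), of x] by auto
          then show ?thesis using xy(3) \<open>x \<notin> J\<close> \<open>y \<in> J\<close> by simp
        next
          assume "x \<notin> J" "y \<notin> J"
          then show ?thesis using xy g(1) by (simp add: inj_on_eq_iff)
        qed
      qed
      moreover have "\<forall>i\<in>I. ?h i \<in> S i" using f g by auto
      ultimately show ?thesis by blast
    next
      case False
      obtain i where i: "i \<in> I" using nonempty by blast
      have "S i \<noteq> {}" using hall[of "{i}"] i by auto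
      then obtain a where a: "a \<in> S i" by blast
      have "card (I - {i}) < card I" using i fI by (meson card_Diff1_less)
      moreover have "card K \<le> card (\<Union>((\<lambda>k. S k - {a}) ` K))" if K: "K \<subseteq> I - {i}" for K
      proof (cases "K = {}")
        case True
        then show ?thesis by simp
      next
        case Kne: False
        have "K \<subset> I" using K i by auto
        then have "card (\<Union>(S ` K)) \<noteq> card K" "card K \<le> card (\<Union>(S ` K))"
          using spec[OF False[unfolded not_ex], of K] Kne hall[of K] by simp_all
        then have "card K < card (\<Union>(S ` K))" by simp
        moreover have "\<Union>((\<lambda>k. S k - {a}) ` K) = \<Union>(S ` K) - {a}" by blast
        moreover have "card (\<Union>(S ` K)) - 1 \<le> card (\<Union>(S ` K) - {a})"
          by (simp add: card_Diff_singleton_if)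
        ultimately show ?thesis by simp
      qed
      moreover have "finite (I - {i})" "\<And>k. k \<in> I - {i} \<Longrightarrow> finite (S k - {a})" using fI fS by auto
      ultimately have "\<exists>g. inj_on g (I - {i}) \<and> (\<forall>k\<in>I - {i}. g k \<in> S k - {a})"
        using less.hyps[of "I - {i}" "\<lambda>k. S k - {a}"] by blast
      then obtain g where g: "inj_on g (I - {i})" "\<forall>k\<in>I - {i}. g k \<in> S k - {a}" by blast
      have "inj_on (g(i := a)) I"
        using g by (auto simp: inj_on_def)
      moreover have "\<forall>k\<in>I. (g(i := a)) k \<in> S k" using g a by auto
      ultimately show ?thesis by blast
    qed
  qed
qed

text \<open>Hall's condition holds for the supports of the rows by double counting: the rows in \<open>J\<close>
  carry total weight \<open>t * card J\<close>, all of it inside the columns they meet, and \<open>k\<close> columns carry weight \<open>t * k\<close>.\<close>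

lemma positive_diagonal:
  fixes S :: "'a \<Rightarrow> 'a \<Rightarrow> real"
  assumes "finite I" and nn: "\<And>i j. i \<in> I \<Longrightarrow> j \<in> I \<Longrightarrow> 0 \<le> S i j"
    and row: "\<And>i. i \<in> I \<Longrightarrow> (\<Sum>j\<in>I. S i j) = t"
    and col: "\<And>j. j \<in> I \<Longrightarrow> (\<Sum>i\<in>I. S i j) = t" and t: "0 < t"
  shows "\<exists>p. bij_betw p I I \<and> (\<forall>i\<in>I. 0 < S i (p i))"
proof -
  let ?N = "\<lambda>i. {j\<in>I. 0 < S i j}"
  have "card J \<le> card (\<Union>(?N ` J))" if J: "J \<subseteq> I" for J
  proof -
    let ?M = "\<Union>(?N ` J)"
    have M: "?M \<subseteq> I" by auto
    have "t * card J = (\<Sum>i\<in>J. \<Sum>j\<in>I. S i j)"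
      using J row by (simp add: subset_iff)
    also have "\<dots> = (\<Sum>i\<in>J. \<Sum>j\<in>?M. S i j)"
    proof (rule sum.cong[OF refl])
      fix i assume i: "i \<in> J"
      have "S i j = 0" if "j \<in> I - ?M" for j
        using nn[of i j] i that J by force
      then show "(\<Sum>j\<in>I. S i j) = (\<Sum>j\<in>?M. S i j)"
        using \<open>finite I\<close> M by (intro sum.mono_neutral_right) auto
    qed
    also have "\<dots> = (\<Sum>j\<in>?M. \<Sum>i\<in>J. S i j)" by (rule sum.swap)
    also have "\<dots> \<le> (\<Sum>j\<in>?M. \<Sum>i\<in>I. S i j)"
      using J nn \<open>finite I\<close> by (intro sum_mono sum_mono2) auto
    also have "\<dots> = t * card ?M" using M col by (simp add: subset_iff)
    finally show ?thesis using t by simp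
  qed
  moreover have "finite (?N i)" for i using \<open>finite I\<close> by simp
  ultimately obtain p where p: "inj_on p I" "\<forall>i\<in>I. p i \<in> ?N i"
    using hall_marriage[OF \<open>finite I\<close>, of ?N] by meson
  have "p ` I = I"
    using p \<open>finite I\<close> by (intro endo_inj_surj) auto
  then show ?thesis using p by (auto simp: bij_betw_def)
qed

text \<open>This is the part of Birkhoff's theorem that is needed, in the form adapted to an induction on
  the size of the support: the common row and column sum \<open>t\<close> is arbitrary, so that a multiple of a permutation
  matrix can be subtracted without leaving the class. Subtracting the largest multiple that keeps the entries
  nonnegative kills at least one entry.\<close>

lemma doubly_stochastic_functional_nonneg:
  fixes S c :: "'a \<Rightarrow> 'a \<Rightarrow> real"
  assumes "finite I" and "\<And>i j. i \<in> I \<Longrightarrow> j \<in> I \<Longrightarrow> 0 \<le> S i j"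
    and "\<And>i. i \<in> I \<Longrightarrow> (\<Sum>j\<in>I. S i j) = t"
    and "\<And>j. j \<in> I \<Longrightarrow> (\<Sum>i\<in>I. S i j) = t"
    and perm: "\<And>p. bij_betw p I I \<Longrightarrow> 0 \<le> (\<Sum>i\<in>I. c i (p i))"
  shows "0 \<le> (\<Sum>i\<in>I. \<Sum>j\<in>I. c i j * S i j)"
  using assms(2-4)
proof (induction "card {(i,j) \<in> I \<times> I. S i j \<noteq> 0}" arbitrary: S t rule: less_induct)
  case less
  note nn = less.prems(1) and row = less.prems(2) and col = less.prems(3)
  show ?case
  proof (cases "I = {} \<or> t \<le> 0")
    case True
    have "S i j = 0" if "i \<in> I" "j \<in> I" for i j
    proof -
      have "S i j \<le> (\<Sum>j\<in>I. S i j)" using that nn \<open>finite I\<close> by (intro member_le_sum) auto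
      then show ?thesis using row[of i] nn[of i j] that True by auto
    qed
    then show ?thesis by simp
  next
    case False
    then have t: "0 < t" and ne: "I \<noteq> {}" by auto
    obtain p where p: "bij_betw p I I" "\<forall>i\<in>I. 0 < S i (p i)"
      using positive_diagonal[OF \<open>finite I\<close> nn row col t] by blast
    have pI: "p i \<in> I" if "i \<in> I" for i using p(1) that bij_betwE by blast
    \<comment> \<open>the largest multiple of the permutation matrix of \<open>p\<close> below \<open>S\<close>\<close>
    define e where "e = Min ((\<lambda>i. S i (p i)) ` I)"
    have "e \<in> (\<lambda>i. S i (p i)) ` I" unfolding e_def using ne \<open>finite I\<close> by (intro Min_in) auto
    then obtain k where k: "k \<in> I" "e = S k (p k)" by blast
    have e_le: "e \<le> S i (p i)" if "i \<in> I" for i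
      unfolding e_def using that \<open>finite I\<close> by (intro Min_le) auto
    have e0: "0 < e" using k p(2) by auto
    define T where "T = (\<lambda>i j. S i j - (if j = p i then e else 0))"
    have Tnn: "0 \<le> T i j" if "i \<in> I" "j \<in> I" for i j
      using that nn e_le by (auto simp: T_def)
    have Trow: "(\<Sum>j\<in>I. T i j) = t - e" if "i \<in> I" for i
      using that row pI \<open>finite I\<close> by (simp add: T_def sum_subtractf)
    have Tcol: "(\<Sum>i\<in>I. T i j) = t - e" if "j \<in> I" for j
    proof -
      have "j \<in> p ` I" using that bij_betw_imp_surj_on[OF p(1)] by simp
      then obtain i0 where i0: "i0 \<in> I" "p i0 = j" by blast
      have "(\<Sum>i\<in>I. if j = p i then e else 0) = (\<Sum>i\<in>I. if i = i0 then e else 0)"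
        using i0 p(1) by (intro sum.cong refl) (auto simp: bij_betw_def inj_on_eq_iff)
      then show ?thesis using that col i0 \<open>finite I\<close> by (simp add: T_def sum_subtractf)
    qed
    let ?supp = "\<lambda>M. {(i,j) \<in> I \<times> I. M i j \<noteq> (0::real)}"
    have fin: "finite (?supp S)"
      by (rule finite_subset[of _ "I \<times> I"]) (use \<open>finite I\<close> in auto)
    have "?supp T \<subseteq> ?supp S - {(k, p k)}"
      using p(2) k by (auto simp: T_def split: if_splits)
    then have "card (?supp T) \<le> card (?supp S - {(k, p k)})"
      using fin by (intro card_mono) auto
    also have "\<dots> < card (?supp S)"
      by (rule card_Diff1_less[OF fin]) (use k e0 pI in auto)
    finally have "card (?supp T) < card (?supp S)" .
    then have "0 \<le> (\<Sum>i\<in>I. \<Sum>j\<in>I. c i j * T i j)"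
      using less.hyps[of T "t - e"] Tnn Trow Tcol by blast
    moreover have "(\<Sum>j\<in>I. c i j * T i j) = (\<Sum>j\<in>I. c i j * S i j) - e * c i (p i)"
      if "i \<in> I" for i
    proof -
      have "(\<Sum>j\<in>I. c i j * T i j) = (\<Sum>j\<in>I. c i j * S i j - (if j = p i then e * c i (p i) else 0))"
        by (intro sum.cong refl) (auto simp: T_def algebra_simps)
      also have "\<dots> = (\<Sum>j\<in>I. c i j * S i j) - e * c i (p i)"
        using that pI \<open>finite I\<close> by (simp add: sum_subtractf)
      finally show ?thesis .
    qed
    ultimately have "0 \<le> (\<Sum>i\<in>I. \<Sum>j\<in>I. c i j * S i j) - e * (\<Sum>i\<in>I. c i (p i))"
      by (simp add: sum_subtractf sum_distrib_left)
    moreover have "0 \<le> e * (\<Sum>i\<in>I. c i (p i))" using perm[OF p(1)] e0 by simp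
    ultimately show ?thesis by linarith
  qed
qed

section \<open>Unitary matrices and the Frobenius norm\<close>

lemma dim_mat_adjoint [simp]:
  "dim_row (mat_adjoint A) = dim_col A" "dim_col (mat_adjoint A) = dim_row A"
  by (simp_all add: mat_adjoint_def)

lemma mat_adjoint_carrier [simp]: "A \<in> carrier_mat n m \<Longrightarrow> mat_adjoint A \<in> carrier_mat m n"
  by (intro carrier_matI) auto

lemma index_mat_adjoint [simp]:
  fixes A :: "complex mat"
  shows "i < dim_col A \<Longrightarrow> j < dim_row A \<Longrightarrow> mat_adjoint A $$ (i, j) = cnj (A $$ (j, i))"
  by (simp add: mat_adjoint_def mat_of_rows_index)

lemma mat_adjoint_adjoint [simp]:
  fixes A :: "complex mat"
  shows "mat_adjoint (mat_adjoint A) = A"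
  by (rule eq_matI) auto

lemma index_mult_sum:
  assumes "A \<in> carrier_mat n m" "B \<in> carrier_mat m k" "i < n" "j < k"
  shows "(A * B) $$ (i, j) = (\<Sum>l<m. A $$ (i, l) * B $$ (l, j))"
  using assms by (simp add: scalar_prod_def lessThan_atLeast0)

lemma mat_adjoint_mult:
  fixes A B :: "complex mat"
  assumes A: "A \<in> carrier_mat n m" and B: "B \<in> carrier_mat m k"
  shows "mat_adjoint (A * B) = mat_adjoint B * mat_adjoint A"
proof (rule eq_matI)
  fix i j assume "i < dim_row (mat_adjoint B * mat_adjoint A)" "j < dim_col (mat_adjoint B * mat_adjoint A)"
  then have i: "i < k" and j: "j < n" using assms by auto
  have "mat_adjoint (A * B) $$ (i, j) = cnj (\<Sum>l<m. A $$ (j, l) * B $$ (l, i))"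
    using A B i j by (simp add: index_mult_sum[OF A B j i])
  also have "\<dots> = (\<Sum>l<m. mat_adjoint B $$ (i, l) * mat_adjoint A $$ (l, j))"
    unfolding cnj_sum by (intro sum.cong refl) (use A B i j in \<open>simp add: mult.commute\<close>)
  also have "\<dots> = (mat_adjoint B * mat_adjoint A) $$ (i, j)"
    by (rule index_mult_sum[symmetric, of _ k m _ n]) (use A B i j in simp_all)
  finally show "mat_adjoint (A * B) $$ (i, j) = (mat_adjoint B * mat_adjoint A) $$ (i, j)" .
qed (use assms in auto)

text \<open>Rebracketing of a product of four factors, stated for the inner pair because it is there that
  \<open>U\<^sup>* U\<close> is going to cancel.\<close>

lemma mult_mat_inner_assoc:
  assumes "P \<in> carrier_mat n1 n2" "Q \<in> carrier_mat n2 n3" "R \<in> carrier_mat n3 n4" "S \<in> carrier_mat n4 n5"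
  shows "(P * Q) * (R * S) = P * (Q * R) * S"
proof -
  have "(P * Q) * (R * S) = P * Q * R * S"
    using assms by (intro assoc_mult_mat[symmetric, of _ n1 n3 _ n4 _ n5]) auto
  also have "P * Q * R = P * (Q * R)"
    using assms by (intro assoc_mult_mat[of _ n1 n2 _ n3 _ n4]) auto
  finally show ?thesis .
qed

lemma cnj_mult_self: "cnj z * z = complex_of_real ((cmod z)\<^sup>2)"
  using complex_norm_square[of z] by (simp add: mult.commute)

lemma mat_adjoint_mat_diag [simp]: "mat_adjoint (mat_diag n f) = mat_diag n (\<lambda>i. cnj (f i))"
  by (rule eq_matI) (auto simp: mat_diag_def)

definition unitary_mat :: "nat \<Rightarrow> complex mat \<Rightarrow> bool" where
  "unitary_mat n U \<longleftrightarrow> U \<in> carrier_mat n n \<and> mat_adjoint U * U = 1\<^sub>m n"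

lemma unitary_matD:
  assumes "unitary_mat n U"
  shows "U \<in> carrier_mat n n" "mat_adjoint U * U = 1\<^sub>m n" "U * mat_adjoint U = 1\<^sub>m n"
proof -
  show U: "U \<in> carrier_mat n n" and 1: "mat_adjoint U * U = 1\<^sub>m n"
    using assms by (auto simp: unitary_mat_def)
  show "U * mat_adjoint U = 1\<^sub>m n"
    by (rule mat_mult_left_right_inverse[OF _ U 1]) (use U in simp)
qed

lemma unitary_mat_adjoint:
  assumes "unitary_mat n U"
  shows "unitary_mat n (mat_adjoint U)"
  unfolding unitary_mat_def using unitary_matD(1,3)[OF assms] by simp

lemma unitary_mat_mult:
  assumes "unitary_mat n U" "unitary_mat n V"
  shows "unitary_mat n (U * V)"
proof -
  note U = unitary_matD[OF assms(1)] and V = unitary_matD[OF assms(2)]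
  have "mat_adjoint (U * V) * (U * V) = mat_adjoint V * (mat_adjoint U * U) * V"
    unfolding mat_adjoint_mult[OF U(1) V(1)]
    by (rule mult_mat_inner_assoc) (use U(1) V(1) in auto)
  also have "\<dots> = 1\<^sub>m n" unfolding U(2) using V(1,2) by simp
  finally show ?thesis using U(1) V(1) by (simp add: unitary_mat_def)
qed

lemma unitary_mat_one: "unitary_mat n (1\<^sub>m n)"
proof -
  have "mat_adjoint (1\<^sub>m n :: complex mat) = 1\<^sub>m n" by (rule eq_matI) auto
  then show ?thesis by (simp add: unitary_mat_def)
qed

lemma unitary_mat_cols:
  assumes "unitary_mat n U" "j < n" "k < n"
  shows "(\<Sum>i<n. cnj (U $$ (i, j)) * U $$ (i, k)) = (if j = k then 1 else 0)"
proof -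
  note U = unitary_matD[OF assms(1)]
  have "(\<Sum>i<n. cnj (U $$ (i, j)) * U $$ (i, k)) = (mat_adjoint U * U) $$ (j, k)"
    using U(1) assms by (subst index_mult_sum[of _ n n _ n]) auto
  then show ?thesis using U(2) assms by simp
qed

lemma unitary_mat_col_sum:
  assumes "unitary_mat n U" "j < n"
  shows "(\<Sum>i<n. (cmod (U $$ (i, j)))\<^sup>2) = 1"
proof -
  have "complex_of_real (\<Sum>i<n. (cmod (U $$ (i, j)))\<^sup>2) = (\<Sum>i<n. cnj (U $$ (i, j)) * U $$ (i, j))"
    unfolding of_real_sum by (intro sum.cong refl) (simp only: cnj_mult_self)
  also have "\<dots> = 1" using unitary_mat_cols[OF assms(1,2,2)] by simp
  finally show ?thesis using of_real_eq_1_iff by blast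
qed

lemma unitary_mat_row_sum:
  assumes "unitary_mat n U" "i < n"
  shows "(\<Sum>j<n. (cmod (U $$ (i, j)))\<^sup>2) = 1"
  using unitary_mat_col_sum[OF unitary_mat_adjoint[OF assms(1)] assms(2)]
    unitary_matD(1)[OF assms(1)] assms(2) by simp

lemma frobenius_norm_sq:
  "A \<in> carrier_mat n m \<Longrightarrow> (frobenius_norm A)\<^sup>2 = (\<Sum>i<n. \<Sum>j<m. (cmod (A $$ (i, j)))\<^sup>2)"
  unfolding frobenius_norm_def by (subst real_sqrt_pow2) (auto intro!: sum_nonneg)

lemma frobenius_norm_nonneg [simp]: "0 \<le> frobenius_norm A"
  unfolding frobenius_norm_def by (auto intro!: sum_nonneg)

lemma frobenius_norm_eqI:
  "(frobenius_norm A)\<^sup>2 = (frobenius_norm B)\<^sup>2 \<Longrightarrow> frobenius_norm A = frobenius_norm B"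
  by (simp add: power2_eq_iff_nonneg)

text \<open>Unitary invariance from the left is immediate in this form, since \<open>U * X\<close> and \<open>X\<close> have the same
  Gram matrix. Invariance from the right then follows by passing to adjoints.\<close>

lemma frobenius_norm_gram:
  assumes A: "A \<in> carrier_mat n m"
  shows "complex_of_real ((frobenius_norm A)\<^sup>2) = (\<Sum>j<m. (mat_adjoint A * A) $$ (j, j))"
proof -
  have "complex_of_real ((frobenius_norm A)\<^sup>2) = (\<Sum>j<m. \<Sum>i<n. complex_of_real ((cmod (A $$ (i, j)))\<^sup>2))"
    unfolding frobenius_norm_sq[OF A] of_real_sum by (rule sum.swap)
  also have "\<dots> = (\<Sum>j<m. (mat_adjoint A * A) $$ (j, j))"
  proof (rule sum.cong[OF refl])
    fix j assume j: "j \<in> {..<m}"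
    have "(mat_adjoint A * A) $$ (j, j) = (\<Sum>i<n. mat_adjoint A $$ (j, i) * A $$ (i, j))"
      by (rule index_mult_sum[of _ m n _ m]) (use A j in auto)
    also have "\<dots> = (\<Sum>i<n. complex_of_real ((cmod (A $$ (i, j)))\<^sup>2))"
      by (intro sum.cong refl) (use A j in \<open>simp add: cnj_mult_self del: of_real_power\<close>)
    finally show "(\<Sum>i<n. complex_of_real ((cmod (A $$ (i, j)))\<^sup>2)) = (mat_adjoint A * A) $$ (j, j)" ..
  qed
  finally show ?thesis .
qed

lemma frobenius_norm_adjoint:
  assumes A: "A \<in> carrier_mat n m"
  shows "frobenius_norm (mat_adjoint A) = frobenius_norm A"
proof (rule frobenius_norm_eqI)
  have "(\<Sum>i<m. \<Sum>j<n. (cmod (mat_adjoint A $$ (i, j)))\<^sup>2) = (\<Sum>i<m. \<Sum>j<n. (cmod (A $$ (j, i)))\<^sup>2)"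
    using A by simp
  also have "\<dots> = (\<Sum>j<n. \<Sum>i<m. (cmod (A $$ (j, i)))\<^sup>2)" by (rule sum.swap)
  finally show "(frobenius_norm (mat_adjoint A))\<^sup>2 = (frobenius_norm A)\<^sup>2"
    by (simp add: frobenius_norm_sq[OF A] frobenius_norm_sq[OF mat_adjoint_carrier[OF A]])
qed

lemma frobenius_norm_unitary_left:
  assumes "unitary_mat n U" and X: "X \<in> carrier_mat n m"
  shows "frobenius_norm (U * X) = frobenius_norm X"
proof (rule frobenius_norm_eqI)
  note U = unitary_matD[OF assms(1)]
  have "mat_adjoint (U * X) * (U * X) = mat_adjoint X * (mat_adjoint U * U) * X"
    unfolding mat_adjoint_mult[OF U(1) X]
    by (rule mult_mat_inner_assoc) (use U(1) X in auto)
  also have "\<dots> = mat_adjoint X * X" unfolding U(2) using X by simp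
  finally have "mat_adjoint (U * X) * (U * X) = mat_adjoint X * X" .
  then have "complex_of_real ((frobenius_norm (U * X))\<^sup>2) = complex_of_real ((frobenius_norm X)\<^sup>2)"
    using frobenius_norm_gram[OF X] frobenius_norm_gram[of "U * X" n m] U(1) X by simp
  then show "(frobenius_norm (U * X))\<^sup>2 = (frobenius_norm X)\<^sup>2"
    using of_real_eq_iff by blast
qed

lemma frobenius_norm_unitary_right:
  assumes "unitary_mat n U" and X: "X \<in> carrier_mat m n"
  shows "frobenius_norm (X * U) = frobenius_norm X"
proof -
  note U = unitary_matD[OF assms(1)]
  have "frobenius_norm (X * U) = frobenius_norm (mat_adjoint U * mat_adjoint X)"
    using frobenius_norm_adjoint[of "X * U" m n] X U(1) by (simp add: mat_adjoint_mult[OF X U(1)])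
  also have "\<dots> = frobenius_norm X"
    using frobenius_norm_unitary_left[OF unitary_mat_adjoint[OF assms(1)] mat_adjoint_carrier[OF X]]
      frobenius_norm_adjoint[OF X] by simp
  finally show ?thesis .
qed

text \<open>The central formula. Multiplying the difference by \<open>U\<^sup>*\<close> from the left and by \<open>V\<close> from the right
  does not change its norm and turns it into \<open>D\<^sub>a W - W D\<^sub>b\<close> with \<open>W = U\<^sup>* V\<close>, whose entries are
  \<open>(a i - b j) * W i j\<close>. The weights on the right do not depend on \<open>a\<close> and \<open>b\<close>; hence the distance of two normal
  matrices and the distance of their absolute values are governed by one and the same matrix of weights.\<close>

lemma frobenius_norm_diff_diagonalised:
  assumes "unitary_mat n U" "unitary_mat n V"
  shows "(frobenius_norm (U * mat_diag n a * mat_adjoint U - V * mat_diag n b * mat_adjoint V))\<^sup>2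
    = (\<Sum>i<n. \<Sum>j<n. (cmod (a i - b j))\<^sup>2 * (cmod ((mat_adjoint U * V) $$ (i, j)))\<^sup>2)"
proof -
  note U = unitary_matD[OF assms(1)] and V = unitary_matD[OF assms(2)]
  define W where "W = mat_adjoint U * V"
  define A where "A = U * mat_diag n a * mat_adjoint U"
  define B where "B = V * mat_diag n b * mat_adjoint V"
  note [simp] = mult_carrier_mat[of _ n n _ n] left_mult_one_mat[of _ n n] right_mult_one_mat[of _ n n]
  note assoc = assoc_mult_mat[of _ n n _ n _ n]
  have U': "mat_adjoint U \<in> carrier_mat n n" and V': "mat_adjoint V \<in> carrier_mat n n"
    using U V by auto
  have W: "W \<in> carrier_mat n n" using U V unfolding W_def by auto
  have A: "A \<in> carrier_mat n n" using U unfolding A_def by auto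
  have B: "B \<in> carrier_mat n n" using V unfolding B_def by auto
  have "mat_adjoint U * (A * V) = mat_adjoint U * (U * (mat_diag n a * W))"
    unfolding A_def W_def using U(1) U' V(1) by (simp add: assoc)
  also have "\<dots> = (mat_adjoint U * U) * (mat_diag n a * W)"
    by (rule assoc[symmetric]) (use U(1) U' W in auto)
  finally have AV: "mat_adjoint U * (A * V) = mat_diag n a * W" using U(2) W by simp
  have "mat_adjoint U * (B * V) = mat_adjoint U * (V * mat_diag n b * (mat_adjoint V * V))"
    unfolding B_def using V(1) V' by (simp add: assoc)
  also have "\<dots> = mat_adjoint U * (V * mat_diag n b)" using V by simp
  also have "\<dots> = W * mat_diag n b" unfolding W_def
    by (rule assoc[symmetric]) (use U' V(1) in auto)
  finally have BV: "mat_adjoint U * (B * V) = W * mat_diag n b" .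
  have "mat_adjoint U * ((A - B) * V) = mat_adjoint U * (A * V - B * V)"
    using A B V(1) by (simp add: minus_mult_distrib_mat)
  also have "\<dots> = mat_adjoint U * (A * V) - mat_adjoint U * (B * V)"
    using A B V(1) U' by (intro mult_minus_distrib_mat[of _ n n]) auto
  finally have eq: "mat_adjoint U * ((A - B) * V) = mat_diag n a * W - W * mat_diag n b"
    unfolding AV BV .
  have AB: "A - B \<in> carrier_mat n n" using A B by (intro minus_carrier_mat)
  have "(A - B) * V \<in> carrier_mat n n" using AB V(1) by simp
  then have "frobenius_norm (A - B) = frobenius_norm (mat_adjoint U * ((A - B) * V))"
    using frobenius_norm_unitary_left[OF unitary_mat_adjoint[OF assms(1)]]
      frobenius_norm_unitary_right[OF assms(2) AB] by metis
  then have "(frobenius_norm (A - B))\<^sup>2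
      = (\<Sum>i<n. \<Sum>j<n. (cmod ((mat_diag n a * W - W * mat_diag n b) $$ (i, j)))\<^sup>2)"
    unfolding eq using W by (simp add: frobenius_norm_sq[of _ n n] minus_carrier_mat)
  also have "\<dots> = (\<Sum>i<n. \<Sum>j<n. (cmod (a i - b j))\<^sup>2 * (cmod (W $$ (i, j)))\<^sup>2)"
  proof (intro sum.cong refl)
    fix i j assume ij: "i \<in> {..<n}" "j \<in> {..<n}"
    have "(mat_diag n a * W - W * mat_diag n b) $$ (i, j) = (a i - b j) * W $$ (i, j)"
      using ij W by (simp add: mat_diag_mult_left[OF W] mat_diag_mult_right[OF W] algebra_simps)
    then show "(cmod ((mat_diag n a * W - W * mat_diag n b) $$ (i, j)))\<^sup>2
        = (cmod (a i - b j))\<^sup>2 * (cmod (W $$ (i, j)))\<^sup>2"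
      by (simp add: norm_mult power_mult_distrib)
  qed
  finally show ?thesis unfolding A_def B_def W_def .
qed

section \<open>Spectral decomposition of normal matrices\<close>

lemma unitary_conj_mult:
  assumes "unitary_mat n U" and X: "X \<in> carrier_mat n n" and Y: "Y \<in> carrier_mat n n"
  shows "(U * X * mat_adjoint U) * (U * Y * mat_adjoint U) = U * (X * Y) * mat_adjoint U"
proof -
  note U = unitary_matD[OF assms(1)]
  have U': "mat_adjoint U \<in> carrier_mat n n" using U(1) by simp
  note [simp] = mult_carrier_mat[of _ n n _ n] left_mult_one_mat[of _ n n] right_mult_one_mat[of _ n n]
  have "(U * X * mat_adjoint U) * (U * Y * mat_adjoint U)
      = (U * X * mat_adjoint U) * (U * (Y * mat_adjoint U))"
    using U(1) U' Y by (simp only: assoc_mult_mat[of U n n Y n "mat_adjoint U" n])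
  also have "\<dots> = (U * X) * (mat_adjoint U * U) * (Y * mat_adjoint U)"
    by (rule mult_mat_inner_assoc) (use U(1) U' X Y in auto)
  also have "\<dots> = (U * X) * (Y * mat_adjoint U)"
    unfolding U(2) using U(1) X by simp
  also have "\<dots> = U * (X * Y) * mat_adjoint U"
    by (rule mult_mat_inner_assoc) (use U(1) U' X Y in auto)
  finally show ?thesis .
qed

lemma unitary_conj_adjoint:
  fixes U X :: "complex mat"
  assumes U: "U \<in> carrier_mat n n" and X: "X \<in> carrier_mat n n"
  shows "mat_adjoint (U * X * mat_adjoint U) = U * mat_adjoint X * mat_adjoint U"
proof -
  have U': "mat_adjoint U \<in> carrier_mat n n" and X': "mat_adjoint X \<in> carrier_mat n n" using U X by auto
  have "mat_adjoint (U * X * mat_adjoint U) = mat_adjoint (mat_adjoint U) * mat_adjoint (U * X)"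
    by (rule mat_adjoint_mult[OF mult_carrier_mat[OF U X] U'])
  also have "\<dots> = U * (mat_adjoint X * mat_adjoint U)"
    by (simp add: mat_adjoint_mult[OF U X])
  also have "\<dots> = U * mat_adjoint X * mat_adjoint U"
    by (rule assoc_mult_mat[symmetric, OF U X' U'])
  finally show ?thesis .
qed

lemma unitary_conj_inverse:
  assumes "unitary_mat n U" and X: "X \<in> carrier_mat n n"
  shows "U * (mat_adjoint U * X * U) * mat_adjoint U = X"
proof -
  note U = unitary_matD[OF assms(1)]
  have U': "mat_adjoint U \<in> carrier_mat n n" using U(1) by simp
  note [simp] = mult_carrier_mat[of _ n n _ n] left_mult_one_mat[of _ n n] right_mult_one_mat[of _ n n]
  have "U * (mat_adjoint U * X * U) * mat_adjoint U = U * (mat_adjoint U * X * U * mat_adjoint U)"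
    by (rule assoc_mult_mat[of _ n n _ n _ n]) (use U(1) U' X in auto)
  also have "mat_adjoint U * X * U * mat_adjoint U = mat_adjoint U * X * (U * mat_adjoint U)"
    by (rule assoc_mult_mat[of _ n n _ n _ n]) (use U(1) U' X in auto)
  also have "\<dots> = mat_adjoint U * X" unfolding U(3) using U' X by simp
  also have "U * (mat_adjoint U * X) = (U * mat_adjoint U) * X"
    by (rule assoc_mult_mat[symmetric, of _ n n _ n _ n]) (use U(1) U' X in auto)
  also have "\<dots> = X" unfolding U(3) using X by simp
  finally show ?thesis .
qed

text \<open>Complete \<open>v\<close> to a basis, orthogonalise by Gram and Schmidt, which leaves the first vector alone, and
  normalise each column.\<close>

lemma unitary_first_column:
  fixes v :: "complex vec"
  assumes v: "v \<in> carrier_vec n" and v0: "v \<noteq> 0\<^sub>v n"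
  shows "\<exists>W c. unitary_mat n W \<and> (\<forall>i<n. W $$ (i, 0) = c * v $ i)"
proof -
  interpret cof_vec_space n "TYPE(complex)" .
  define b where "b = basis_completion v"
  define ws where "ws = gram_schmidt n b"
  from basis_completion[OF v v0, folded b_def]
  have dist_b: "distinct b" and indep: "\<not> lin_dep (set b)" and b: "set b \<subseteq> carrier_vec n"
    and hdb: "hd b = v" and len_b: "length b = n" by auto
  have n: "n \<noteq> 0"
  proof
    assume "n = 0"
    then have "v = 0\<^sub>v n" using v by (intro eq_vecI) auto
    then show False using v0 by simp
  qed
  then obtain vs where bv: "b = v # vs" using hdb len_b by (cases b) auto
  from gram_schmidt_result[OF b dist_b indep refl, folded ws_def]
  have ws: "set ws \<subseteq> carrier_vec n" "corthogonal ws" "length ws = n"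
    by (auto simp: len_b)
  have hdws: "hd ws = v" using gram_schmidt_hd[OF v, of vs] unfolding ws_def bv .
  have ws0: "ws ! 0 = v" using hdws ws(3) n by (cases ws) auto
  have wsc: "ws ! j \<in> carrier_vec n" if "j < n" for j using ws that by auto
  define N where "N = (\<lambda>j. sqrt (\<Sum>i<n. (cmod (ws ! j $ i))\<^sup>2))"
  have inner: "ws ! k \<bullet>c ws ! j = (\<Sum>i<n. cnj (ws ! j $ i) * ws ! k $ i)" if "j < n" "k < n" for j k
    using wsc[OF that(1)] wsc[OF that(2)]
    by (simp add: scalar_prod_def lessThan_atLeast0 mult.commute)
  have inner_self: "ws ! j \<bullet>c ws ! j = complex_of_real ((N j)\<^sup>2)" if "j < n" for j
  proof -
    have "(N j)\<^sup>2 = (\<Sum>i<n. (cmod (ws ! j $ i))\<^sup>2)"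
      unfolding N_def by (rule real_sqrt_pow2) (simp add: sum_nonneg)
    then show ?thesis unfolding inner[OF that that] cnj_mult_self by simp
  qed
  have N0: "N j \<noteq> 0" if "j < n" for j
    using inner_self[OF that] corthogonalD[OF ws(2), of j j] ws(3) that by auto
  define W where "W = Matrix.mat n n (\<lambda>(i, j). ws ! j $ i / complex_of_real (N j))"
  have W: "W \<in> carrier_mat n n" unfolding W_def by simp
  have "mat_adjoint W * W = 1\<^sub>m n"
  proof (rule eq_matI)
    fix j k assume "j < dim_row (1\<^sub>m n :: complex mat)" "k < dim_col (1\<^sub>m n :: complex mat)"
    then have j: "j < n" and k: "k < n" by auto
    have "(mat_adjoint W * W) $$ (j, k) = (\<Sum>i<n. mat_adjoint W $$ (j, i) * W $$ (i, k))"
      by (rule index_mult_sum[of _ n n _ n]) (use W j k in auto)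
    also have "\<dots> = (\<Sum>i<n. cnj (ws ! j $ i) * ws ! k $ i / complex_of_real (N j * N k))"
      using j k W by (intro sum.cong refl) (simp add: W_def)
    also have "\<dots> = (ws ! k \<bullet>c ws ! j) / complex_of_real (N j * N k)"
      by (simp add: inner[OF j k] sum_divide_distrib)
    also have "\<dots> = (1\<^sub>m n) $$ (j, k)"
    proof (cases "j = k")
      case True
      then show ?thesis using inner_self[OF j] N0[OF j] j by (simp add: power2_eq_square)
    next
      case False
      then show ?thesis using corthogonalD[OF ws(2), of k j] ws(3) j k by simp
    qed
    finally show "(mat_adjoint W * W) $$ (j, k) = (1\<^sub>m n) $$ (j, k)" .
  qed (use W in auto)
  then have "unitary_mat n W" using W by (simp add: unitary_mat_def)
  moreover have "W $$ (i, 0) = (1 / complex_of_real (N 0)) * v $ i" if "i < n" for i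
    using that n ws0 by (simp add: W_def)
  ultimately show ?thesis by blast
qed

text \<open>Induction on the size. A unitary change of basis that starts with an eigenvector for \<open>e\<close> makes the
  first column \<open>(e, 0, \<dots>, 0)\<close>. For a normal matrix the first row and the first column have the same length, so
  the first row is \<open>(e, 0, \<dots>, 0)\<close> as well and the matrix splits off a normal block of size one less. The
  eigenvalues appear in the order in which the factorisation of the characteristic polynomial lists them, which is
  what allows the order of a given listing to be used later on.\<close>

theorem normal_spectral_decomposition:
  fixes A :: "complex mat"
  assumes "A \<in> carrier_mat n n" "mat_adjoint A * A = A * mat_adjoint A"
    and "char_poly A = (\<Prod>e\<leftarrow>es. [:- e, 1:])"
  shows "\<exists>U. unitary_mat n U \<and> A = U * mat_diag n (\<lambda>i. es ! i) * mat_adjoint U"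
  using assms
proof (induction es arbitrary: n A)
  case Nil
  then have "n = 0" using degree_monic_char_poly[of A n] by simp
  then show ?case using Nil(1) unitary_mat_one[of 0] by (intro exI[of _ "1\<^sub>m 0"]) (auto intro!: eq_matI)
next
  case (Cons e es)
  note A = Cons.prems(1) and normal = Cons.prems(2) and cp = Cons.prems(3)
  define m where "m = length es"
  have n: "n = Suc m"
    using degree_monic_char_poly[OF A] degree_linear_factors[of uminus "e # es"]
    unfolding cp m_def by simp
  then have n0: "0 < n" by simp
  have "eigenvalue A e" unfolding eigenvalue_root_char_poly[OF A] cp by simp
  then obtain v where "eigenvector A v e" unfolding eigenvalue_def by blast
  then have v: "v \<in> carrier_vec n" "v \<noteq> 0\<^sub>v n" "A *\<^sub>v v = e \<cdot>\<^sub>v v"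
    using A unfolding eigenvector_def by auto
  obtain W c where uW: "unitary_mat n W" and Wv: "\<And>i. i < n \<Longrightarrow> W $$ (i, 0) = c * v $ i"
    using unitary_first_column[OF v(1,2)] by blast
  note W = unitary_matD[OF uW]
  have W': "mat_adjoint W \<in> carrier_mat n n" using W(1) by simp
  define A' where "A' = mat_adjoint W * A * W"
  have A': "A' \<in> carrier_mat n n" using W(1) W' A unfolding A'_def by auto
  have A'_alt: "A' = mat_adjoint W * A * mat_adjoint (mat_adjoint W)" unfolding A'_def by simp
  have A_A': "A = W * A' * mat_adjoint W"
    unfolding A'_def by (rule unitary_conj_inverse[OF uW A, symmetric])
  have A'_adj: "mat_adjoint A' = mat_adjoint W * mat_adjoint A * mat_adjoint (mat_adjoint W)"
    unfolding A'_alt by (rule unitary_conj_adjoint[OF W' A])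
  have A'_normal: "mat_adjoint A' * A' = A' * mat_adjoint A'"
    unfolding A'_adj unfolding A'_alt
    unfolding unitary_conj_mult[OF unitary_mat_adjoint[OF uW] mat_adjoint_carrier[OF A] A]
      unitary_conj_mult[OF unitary_mat_adjoint[OF uW] A mat_adjoint_carrier[OF A]] normal ..
  have AW0: "(A * W) $$ (k, 0) = e * W $$ (k, 0)" if k: "k < n" for k
  proof -
    have "(A * W) $$ (k, 0) = (\<Sum>l<n. A $$ (k, l) * W $$ (l, 0))"
      by (rule index_mult_sum[OF A W(1) k]) (simp add: n)
    also have "\<dots> = c * (\<Sum>l<n. A $$ (k, l) * v $ l)"
      unfolding sum_distrib_left by (intro sum.cong refl) (simp add: Wv)
    also have "(\<Sum>l<n. A $$ (k, l) * v $ l) = (A *\<^sub>v v) $ k"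
      using A v(1) k by (simp add: scalar_prod_def lessThan_atLeast0)
    also have "\<dots> = e * v $ k" using v k by simp
    finally show ?thesis using Wv[OF k] by simp
  qed
  have col0: "A' $$ (i, 0) = (if i = 0 then e else 0)" if i: "i < n" for i
  proof -
    have "A' = mat_adjoint W * (A * W)"
      unfolding A'_def by (rule assoc_mult_mat[OF W' A W(1)])
    then have "A' $$ (i, 0) = (\<Sum>k<n. mat_adjoint W $$ (i, k) * (A * W) $$ (k, 0))"
      using index_mult_sum[OF W' mult_carrier_mat[OF A W(1)] i] n by simp
    also have "\<dots> = e * (\<Sum>k<n. cnj (W $$ (k, i)) * W $$ (k, 0))"
      unfolding sum_distrib_left
    proof (rule sum.cong[OF refl])
      fix k assume "k \<in> {..<n}"
      then have k: "k < n" by simp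
      show "mat_adjoint W $$ (i, k) * (A * W) $$ (k, 0) = e * (cnj (W $$ (k, i)) * W $$ (k, 0))"
        unfolding AW0[OF k] using W(1) i k by simp
    qed
    also have "\<dots> = (if i = 0 then e else 0)"
      using unitary_mat_cols[OF uW i, of 0] n by simp
    finally show ?thesis .
  qed
  \<comment> \<open>Compare the corner entries of \<open>A' A'\<^sup>*\<close> and \<open>A'\<^sup>* A'\<close>: squared lengths of first row and first column.\<close>
  have row0: "A' $$ (0, Suc k) = 0" if k: "k < m" for k
  proof -
    have "(\<Sum>k<n. complex_of_real ((cmod (A' $$ (0, k)))\<^sup>2)) = (A' * mat_adjoint A') $$ (0, 0)"
      using A' n0 by (subst index_mult_sum[of _ n n _ n])
        (auto intro!: sum.cong simp: complex_norm_square simp del: of_real_power)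
    also have "\<dots> = (\<Sum>k<n. complex_of_real ((cmod (A' $$ (k, 0)))\<^sup>2))"
      unfolding A'_normal[symmetric] using A' n0 by (subst index_mult_sum[of _ n n _ n])
        (auto intro!: sum.cong simp: cnj_mult_self simp del: of_real_power)
    finally have "(\<Sum>k<n. (cmod (A' $$ (0, k)))\<^sup>2) = (\<Sum>k<n. (cmod (A' $$ (k, 0)))\<^sup>2)"
      unfolding of_real_sum[symmetric] of_real_eq_iff .
    then have "(\<Sum>k<m. (cmod (A' $$ (0, Suc k)))\<^sup>2) = 0"
      using col0 unfolding n sum.lessThan_Suc_shift by simp
    then show ?thesis using k by (subst (asm) sum_nonneg_eq_0_iff) auto
  qed
  define C where "C = Matrix.mat m m (\<lambda>(i, j). A' $$ (Suc i, Suc j))"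
  have C: "C \<in> carrier_mat m m" unfolding C_def by simp
  let ?E = "Matrix.mat 1 1 (\<lambda>_. e)"
  have A'_block: "A' = four_block_mat ?E (0\<^sub>m 1 m) (0\<^sub>m m 1) C"
  proof (rule eq_matI)
    fix i j
    assume "i < dim_row (four_block_mat ?E (0\<^sub>m 1 m) (0\<^sub>m m 1) C)"
      "j < dim_col (four_block_mat ?E (0\<^sub>m 1 m) (0\<^sub>m m 1) C)"
    then have "i < n" "j < n" using C n by auto
    then show "A' $$ (i, j) = four_block_mat ?E (0\<^sub>m 1 m) (0\<^sub>m m 1) C $$ (i, j)"
      using C col0[of i] row0[of "j - 1"] n by (cases i; cases j) (auto simp: C_def)
  qed (use A' C n in auto)
  have "similar_mat A A'"
    unfolding similar_mat_def using similar_mat_witI[OF W(3) W(2) A_A' A A' W(1) W'] by blast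
  then have "char_poly A' = [:- e, 1:] * (\<Prod>e\<leftarrow>es. [:- e, 1:])"
    using char_poly_similar[of A A'] cp by simp
  moreover have "char_poly A' = char_poly ?E * char_poly C"
    unfolding A'_block by (rule char_poly_four_block_zeros_col) (use C in auto)
  moreover have "char_poly ?E = [:- e, 1:]"
    by (simp add: char_poly_defs det_def sign_def)
  ultimately have cpC: "char_poly C = (\<Prod>e\<leftarrow>es. [:- e, 1:])"
    by (metis mult_cancel_left pCons_eq_0_iff zero_neq_one)
  have "mat_adjoint C * C = C * mat_adjoint C"
  proof (rule eq_matI)
    fix i j assume "i < dim_row (C * mat_adjoint C)" "j < dim_col (C * mat_adjoint C)"
    then have i: "i < m" and j: "j < m" using C by auto
    have "(mat_adjoint C * C) $$ (i, j) = (\<Sum>k<m. cnj (A' $$ (Suc k, Suc i)) * A' $$ (Suc k, Suc j))"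
      using C i j by (subst index_mult_sum[of _ m m _ m]) (auto simp: C_def intro!: sum.cong)
    also have "\<dots> = (mat_adjoint A' * A') $$ (Suc i, Suc j)"
      using A' n i j row0 by (subst index_mult_sum[of _ n n _ n]) (auto simp: sum.lessThan_Suc_shift simp del: sum.lessThan_Suc)
    also have "\<dots> = (A' * mat_adjoint A') $$ (Suc i, Suc j)" unfolding A'_normal ..
    also have "\<dots> = (\<Sum>k<m. A' $$ (Suc i, Suc k) * cnj (A' $$ (Suc j, Suc k)))"
      using A' n i j col0 by (subst index_mult_sum[of _ n n _ n]) (auto simp: sum.lessThan_Suc_shift simp del: sum.lessThan_Suc)
    also have "\<dots> = (C * mat_adjoint C) $$ (i, j)"
      using C i j by (subst index_mult_sum[of _ m m _ m]) (auto simp: C_def intro!: sum.cong)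
    finally show "(mat_adjoint C * C) $$ (i, j) = (C * mat_adjoint C) $$ (i, j)" .
  qed (use C in auto)
  from Cons.IH[OF C this cpC] obtain V
    where uV: "unitary_mat m V" and CV: "C = V * mat_diag m (\<lambda>i. es ! i) * mat_adjoint V" by blast
  note V = unitary_matD[OF uV]
  have V': "mat_adjoint V \<in> carrier_mat m m" using V(1) by simp
  define F where "F = four_block_mat (1\<^sub>m 1) (0\<^sub>m 1 m) (0\<^sub>m m 1) V"
  have F: "F \<in> carrier_mat n n" unfolding F_def n using V(1) by auto
  have F': "mat_adjoint F = four_block_mat (1\<^sub>m 1) (0\<^sub>m 1 m) (0\<^sub>m m 1) (mat_adjoint V)"
    unfolding F_def using V(1) by (intro eq_matI) auto
  have D: "mat_diag n (\<lambda>i. (e # es) ! i)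
      = four_block_mat ?E (0\<^sub>m 1 m) (0\<^sub>m m 1) (mat_diag m (\<lambda>i. es ! i))"
    unfolding n by (intro eq_matI) (auto simp: mat_diag_def)
  have "mat_adjoint F * F = four_block_mat (1\<^sub>m 1) (0\<^sub>m 1 m) (0\<^sub>m m 1) (1\<^sub>m m)"
    unfolding F' unfolding F_def
    by (subst mult_four_block_mat[of _ 1 1 _ m _ m _ _ 1 _ m]) (use V V' in auto)
  then have uF: "unitary_mat n F" using F n by (simp add: unitary_mat_def)
  have "F * mat_diag n (\<lambda>i. (e # es) ! i)
      = four_block_mat ?E (0\<^sub>m 1 m) (0\<^sub>m m 1) (V * mat_diag m (\<lambda>i. es ! i))"
    unfolding D F_def
    by (subst mult_four_block_mat[of _ 1 1 _ m _ m _ _ 1 _ m])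
      (use V in \<open>auto simp: left_mult_zero_mat[of _ m m]\<close>)
  then have "F * mat_diag n (\<lambda>i. (e # es) ! i) * mat_adjoint F = four_block_mat ?E (0\<^sub>m 1 m) (0\<^sub>m m 1) C"
    unfolding F' CV using V(1) V'
    by (simp add: mult_four_block_mat[of _ 1 1 _ m _ m _ _ 1 _ m] mult_carrier_mat[of _ m m _ m]
        right_mult_zero_mat[of _ m m])
  then have A'F: "A' = F * mat_diag n (\<lambda>i. (e # es) ! i) * mat_adjoint F"
    unfolding A'_block ..
  have "A = W * (F * mat_diag n (\<lambda>i. (e # es) ! i) * mat_adjoint F) * mat_adjoint W"
    using A_A' unfolding A'F .
  also have "\<dots> = (W * F) * mat_diag n (\<lambda>i. (e # es) ! i) * (mat_adjoint F * mat_adjoint W)"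
    using W(1) W' F by (simp add: assoc_mult_mat[of _ n n _ n _ n] mult_carrier_mat[of _ n n _ n])
  also have "mat_adjoint F * mat_adjoint W = mat_adjoint (W * F)"
    by (rule mat_adjoint_mult[OF W(1) F, symmetric])
  finally show ?case using unitary_mat_mult[OF uW uF] by blast
qed

section \<open>Positive semidefinite square roots and the matrix absolute value\<close>

lemma mat_diag_cong: "(\<And>i. i < n \<Longrightarrow> f i = g i) \<Longrightarrow> mat_diag n f = mat_diag n g"
  unfolding mat_diag_def by (intro eq_matI) auto

lemma mat_diag_inj:
  assumes "mat_diag n f = mat_diag n g" "i < n"
  shows "f i = g i"
proof -
  have "mat_diag n f $$ (i, i) = mat_diag n g $$ (i, i)" using assms(1) by simp
  then show ?thesis using assms(2) by (simp add: mat_diag_def)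
qed

lemma frobenius_norm_diff_eq_0D:
  assumes A: "A \<in> carrier_mat n m" and B: "B \<in> carrier_mat n m" and "frobenius_norm (A - B) = 0"
  shows "A = B"
proof (rule eq_matI)
  have AB: "A - B \<in> carrier_mat n m" using B by (rule minus_carrier_mat)
  have "(\<Sum>i<n. \<Sum>j<m. (cmod ((A - B) $$ (i, j)))\<^sup>2) = 0"
    using frobenius_norm_sq[OF AB] assms(3) by simp
  then have eq: "\<forall>i<n. (\<Sum>j<m. (cmod ((A - B) $$ (i, j)))\<^sup>2) = 0"
    by (subst (asm) sum_nonneg_eq_0_iff) (auto intro: sum_nonneg)
  fix i j assume "i < dim_row B" "j < dim_col B"
  then have i: "i < n" and j: "j < m" using B by auto
  have "(\<Sum>j<m. (cmod ((A - B) $$ (i, j)))\<^sup>2) = 0" using eq i by blast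
  then have "\<forall>j<m. (cmod ((A - B) $$ (i, j)))\<^sup>2 = 0"
    by (subst (asm) sum_nonneg_eq_0_iff) auto
  then have "(A - B) $$ (i, j) = 0" using j by simp
  then show "A $$ (i, j) = B $$ (i, j)" using A B i j by simp
qed (use A B in auto)

lemma quadratic_form_diagonalised:
  assumes U: "U \<in> carrier_mat n n" and v: "v \<in> carrier_vec n"
  shows "((U * mat_diag n a * mat_adjoint U) *\<^sub>v v) \<bullet>c v
    = (\<Sum>k<n. a k * complex_of_real ((cmod ((mat_adjoint U *\<^sub>v v) $ k))\<^sup>2))"
proof -
  define w where "w = mat_adjoint U *\<^sub>v v"
  have U': "mat_adjoint U \<in> carrier_mat n n" using U by simp
  have D: "mat_diag n a \<in> carrier_mat n n" by simp
  have UD: "U * mat_diag n a \<in> carrier_mat n n" by (rule mult_carrier_mat[OF U D])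
  have w: "w \<in> carrier_vec n" unfolding w_def using U' v by (rule mult_mat_vec_carrier)
  have w_k: "w $ k = (\<Sum>i<n. cnj (U $$ (i, k)) * v $ i)" if "k < n" for k
    unfolding w_def using U v that by (simp add: scalar_prod_def lessThan_atLeast0)
  have "((U * mat_diag n a * mat_adjoint U) *\<^sub>v v) \<bullet>c v = ((U * mat_diag n a) *\<^sub>v w) \<bullet>c v"
    unfolding w_def by (simp only: assoc_mult_mat_vec[OF UD U' v])
  also have "\<dots> = (\<Sum>i<n. (\<Sum>k<n. U $$ (i, k) * a k * w $ k) * cnj (v $ i))"
    using v w U by (simp add: scalar_prod_def lessThan_atLeast0 mat_diag_mult_right[OF U])
  also have "\<dots> = (\<Sum>i<n. \<Sum>k<n. a k * (w $ k * (U $$ (i, k) * cnj (v $ i))))"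
    unfolding sum_distrib_right by (intro sum.cong refl) (simp only: ac_simps)
  also have "\<dots> = (\<Sum>k<n. \<Sum>i<n. a k * (w $ k * (U $$ (i, k) * cnj (v $ i))))"
    by (rule sum.swap)
  also have "\<dots> = (\<Sum>k<n. a k * (w $ k * cnj (w $ k)))"
    by (intro sum.cong refl) (simp add: w_k sum_distrib_left)
  also have "\<dots> = (\<Sum>k<n. a k * complex_of_real ((cmod (w $ k))\<^sup>2))"
    by (intro sum.cong refl) (simp only: complex_norm_square)
  finally show ?thesis unfolding w_def .
qed

lemma positive_semidefinite_diagonalised:
  assumes "unitary_mat n U" and q: "\<And>i. i < n \<Longrightarrow> 0 \<le> q i"
  shows "positive_semidefinite (U * mat_diag n (\<lambda>i. complex_of_real (q i)) * mat_adjoint U)"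
    (is "positive_semidefinite ?P")
proof -
  note U = unitary_matD[OF assms(1)]
  have D: "mat_diag n (\<lambda>i. complex_of_real (q i)) \<in> carrier_mat n n" by simp
  have P: "?P \<in> carrier_mat n n"
    by (rule mult_carrier_mat[OF mult_carrier_mat[OF U(1) D] mat_adjoint_carrier[OF U(1)]])
  have "mat_adjoint ?P = ?P"
    unfolding unitary_conj_adjoint[OF U(1) D] by simp
  moreover have "0 \<le> Re ((?P *\<^sub>v v) \<bullet>c v)" if "v \<in> carrier_vec n" for v
    unfolding quadratic_form_diagonalised[OF U(1) that] Re_sum
    by (rule sum_nonneg) (use q in \<open>auto simp del: of_real_power\<close>)
  ultimately show ?thesis using P unfolding positive_semidefinite_def by auto
qed

text \<open>A Hermitian matrix is normal. Its diagonal form is again Hermitian, so the eigenvalues are real, and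
  each of them is the value of the quadratic form at the corresponding column of \<open>V\<close>.\<close>

lemma positive_semidefinite_spectral:
  assumes psd: "positive_semidefinite P" and P: "P \<in> carrier_mat n n"
  shows "\<exists>V q. unitary_mat n V \<and> (\<forall>i<n. 0 \<le> q i)
    \<and> P = V * mat_diag n (\<lambda>i. complex_of_real (q i)) * mat_adjoint V"
proof -
  have adj: "mat_adjoint P = P" using psd by (simp add: positive_semidefinite_def)
  obtain es where es: "char_poly P = (\<Prod>e\<leftarrow>es. [:- e, 1:])" using char_poly_factorized[OF P] by blast
  obtain V where uV: "unitary_mat n V" and PV: "P = V * mat_diag n (\<lambda>i. es ! i) * mat_adjoint V"
    using normal_spectral_decomposition[OF P _ es] adj by auto
  note V = unitary_matD[OF uV]
  let ?D = "mat_diag n (\<lambda>i. es ! i)" and ?D' = "mat_diag n (\<lambda>i. cnj (es ! i))"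
  have cancel: "mat_adjoint V * (V * M * mat_adjoint V) * V = M" if "M \<in> carrier_mat n n" for M
    using unitary_conj_inverse[OF unitary_mat_adjoint[OF uV] that] by simp
  have "V * ?D' * mat_adjoint V = V * ?D * mat_adjoint V"
    using adj unfolding PV unitary_conj_adjoint[OF V(1) mat_diag_dim] by simp
  then have DD: "?D' = ?D" using cancel[of ?D] cancel[of ?D'] by simp
  have "es ! i = complex_of_real (Re (es ! i))" if "i < n" for i
    using mat_diag_inj[OF DD that] by (simp add: complex_eq_iff)
  then have "?D = mat_diag n (\<lambda>i. complex_of_real (Re (es ! i)))" by (rule mat_diag_cong)
  moreover have "0 \<le> Re (es ! i)" if i: "i < n" for i
  proof -
    have c: "col V i \<in> carrier_vec n" using V(1) by (intro carrier_vecI) simp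
    have "mat_adjoint V *\<^sub>v col V i = col (mat_adjoint V * V) i"
      using V(1) i by (intro eq_vecI) auto
    then have w: "(mat_adjoint V *\<^sub>v col V i) $ k = (if k = i then 1 else 0)" if "k < n" for k
      unfolding V(2) using i that by simp
    have "(P *\<^sub>v col V i) \<bullet>c col V i = (\<Sum>k<n. es ! k * (if k = i then 1 else 0))"
      unfolding PV quadratic_form_diagonalised[OF V(1) c] by (intro sum.cong refl) (simp add: w)
    also have "\<dots> = (\<Sum>k<n. if k = i then es ! k else 0)" by (intro sum.cong refl) simp
    also have "\<dots> = es ! i" using i by simp
    finally show ?thesis using psd c P unfolding positive_semidefinite_def by auto
  qed
  ultimately show ?thesis using uV PV by metis
qed

text \<open>Existence of the square root is a computation. For uniqueness, diagonalise another square root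
  \<open>Q = V diag(q) V\<^sup>*\<close> and apply the formula for the Frobenius distance twice: the squares coincide, so
  \<open>W i j \<noteq> 0\<close> forces \<open>\<bar>d i\<bar>\<^sup>2 = (q j)\<^sup>2\<close>, hence \<open>\<bar>d i\<bar> = q j\<close> as both are nonnegative, and so the distance of
  the two roots vanishes as well.\<close>

lemma mat_abs_diagonalised:
  assumes uU: "unitary_mat n U"
  shows "mat_abs (U * mat_diag n d * mat_adjoint U)
    = U * mat_diag n (\<lambda>i. complex_of_real (cmod (d i))) * mat_adjoint U"
    (is "mat_abs ?A = ?P")
  unfolding mat_abs_def
proof (rule the_equality)
  note U = unitary_matD[OF uU]
  have carr: "U * mat_diag n f * mat_adjoint U \<in> carrier_mat n n" for f
    by (rule mult_carrier_mat[OF mult_carrier_mat[OF U(1) mat_diag_dim] mat_adjoint_carrier[OF U(1)]])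
  have AA: "mat_adjoint ?A * ?A = U * mat_diag n (\<lambda>i. complex_of_real ((cmod (d i))\<^sup>2)) * mat_adjoint U"
    unfolding unitary_conj_adjoint[OF U(1) mat_diag_dim] mat_adjoint_mat_diag
      unitary_conj_mult[OF uU mat_diag_dim mat_diag_dim] mat_diag_diag cnj_mult_self ..
  have PP: "?P * ?P = U * mat_diag n (\<lambda>i. complex_of_real ((cmod (d i))\<^sup>2)) * mat_adjoint U"
    unfolding unitary_conj_mult[OF uU mat_diag_dim mat_diag_dim] mat_diag_diag
    by (simp add: power2_eq_square)
  show "positive_semidefinite ?P \<and> ?P * ?P = mat_adjoint ?A * ?A"
    using positive_semidefinite_diagonalised[OF uU] AA PP by simp
  fix Q assume Q: "positive_semidefinite Q \<and> Q * Q = mat_adjoint ?A * ?A"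
  have "Q * Q \<in> carrier_mat n n" using Q carr AA by metis
  then have "dim_row Q = n" by (metis carrier_matD(1) index_mult_mat(2))
  then have Qc: "Q \<in> carrier_mat n n"
    using Q unfolding positive_semidefinite_def by (intro carrier_matI) auto
  obtain V q where uV: "unitary_mat n V" and q: "\<forall>i<n. 0 \<le> q i"
    and QV: "Q = V * mat_diag n (\<lambda>i. complex_of_real (q i)) * mat_adjoint V"
    using positive_semidefinite_spectral[of Q n] Q Qc by blast
  define W where "W = mat_adjoint U * V"
  have QQ: "Q * Q = V * mat_diag n (\<lambda>i. complex_of_real ((q i)\<^sup>2)) * mat_adjoint V"
    unfolding QV unitary_conj_mult[OF uV mat_diag_dim mat_diag_dim] mat_diag_diag
    by (simp add: power2_eq_square)
  have eq: "U * mat_diag n (\<lambda>i. complex_of_real ((cmod (d i))\<^sup>2)) * mat_adjoint U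
      = V * mat_diag n (\<lambda>i. complex_of_real ((q i)\<^sup>2)) * mat_adjoint V"
    using Q AA QQ by simp
  have "frobenius_norm (0\<^sub>m n n) = 0" unfolding frobenius_norm_def by simp
  then have "(\<Sum>i<n. \<Sum>j<n. (cmod (complex_of_real ((cmod (d i))\<^sup>2) - complex_of_real ((q j)\<^sup>2)))\<^sup>2
      * (cmod (W $$ (i, j)))\<^sup>2) = 0"
    using frobenius_norm_diff_diagonalised[OF uU uV, of "\<lambda>i. complex_of_real ((cmod (d i))\<^sup>2)"
        "\<lambda>i. complex_of_real ((q i)\<^sup>2)"] carr[of "\<lambda>i. complex_of_real ((cmod (d i))\<^sup>2)"]
    unfolding eq[symmetric] W_def by (simp del: of_real_power)
  then have "\<forall>i<n. (\<Sum>j<n. (cmod (complex_of_real ((cmod (d i))\<^sup>2) - complex_of_real ((q j)\<^sup>2)))\<^sup>2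
      * (cmod (W $$ (i, j)))\<^sup>2) = 0"
    by (subst (asm) sum_nonneg_eq_0_iff) (auto intro: sum_nonneg)
  then have zero: "(cmod (complex_of_real ((cmod (d i))\<^sup>2) - complex_of_real ((q j)\<^sup>2)))\<^sup>2
      * (cmod (W $$ (i, j)))\<^sup>2 = 0" if "i < n" "j < n" for i j
    using that by (auto simp: sum_nonneg_eq_0_iff simp del: of_real_power)
  have "(cmod (complex_of_real (cmod (d i)) - complex_of_real (q j)))\<^sup>2 * (cmod (W $$ (i, j)))\<^sup>2 = 0"
    if "i < n" "j < n" for i j
  proof (cases "W $$ (i, j) = 0")
    case False
    then have "complex_of_real ((cmod (d i))\<^sup>2) = complex_of_real ((q j)\<^sup>2)"
      using zero[OF that] by (simp del: of_real_power)
    then have "(cmod (d i))\<^sup>2 = (q j)\<^sup>2" by (simp only: of_real_eq_iff)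
    then have "cmod (d i) = q j" using q that by (simp add: power2_eq_iff_nonneg)
    then show ?thesis by simp
  qed simp
  then have "(frobenius_norm (?P - Q))\<^sup>2 = 0"
    unfolding QV frobenius_norm_diff_diagonalised[OF uU uV] W_def by (intro sum.neutral ballI) simp
  then show "Q = ?P" by (intro frobenius_norm_diff_eq_0D[OF carr Qc, symmetric]) simp
qed

section \<open>Normal matrices with prescribed nonzero eigenvalues\<close>

text \<open>All \<open>n\<close> eigenvalues of a matrix of rank \<open>k\<close>, indexed like matrix entries from \<open>0\<close>, when \<open>l\<close> lists the nonzero
  ones from \<open>1\<close>.\<close>

definition zero_padded :: "nat \<Rightarrow> (nat \<Rightarrow> complex) \<Rightarrow> nat \<Rightarrow> complex" where
  "zero_padded k l i = (if i < k then l (Suc i) else 0)"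

lemma proots_prod_linear_factors:
  fixes as :: "'a :: idom list"
  shows "proots (\<Prod>a\<leftarrow>as. [:- a, 1:]) = mset as"
proof (induction as)
  case (Cons a as)
  have "(\<Prod>a\<leftarrow>as. [:- a, 1:]) \<noteq> 0" by (auto simp: prod_list_zero_iff)
  then have "proots ([:- a, 1:] * (\<Prod>a\<leftarrow>as. [:- a, 1:])) = {#a#} + mset as"
    by (subst proots_mult) (use Cons in simp_all)
  then show ?case by simp
qed simp

text \<open>The characteristic polynomial has \<open>n\<close> roots, so the ones that are not in the listing are \<open>n - k\<close>
  zeros; the spectral decomposition may then be taken in the order of the listing.\<close>

lemma normal_mats_with_diagonalised:
  assumes "A \<in> normal_mats_with n k l"
  shows "\<exists>U. unitary_mat n U \<and> A = U * mat_diag n (zero_padded k l) * mat_adjoint U"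
proof -
  have A: "A \<in> carrier_mat n n" and normal: "mat_adjoint A * A = A * mat_adjoint A"
    and ev: "filter_mset (\<lambda>z. z \<noteq> 0) (proots (char_poly A)) = image_mset l (mset_set {1..k})"
    using assms by (auto simp: normal_mats_with_def normal_mat_def lists_nonzero_eigenvalues_def)
  define M where "M = proots (char_poly A)"
  obtain as where as: "char_poly A = (\<Prod>a\<leftarrow>as. [:- a, 1:])" "length as = n"
    using char_poly_factorized[OF A] by blast
  have M: "M = mset as" unfolding M_def as(1) by (rule proots_prod_linear_factors)
  have M_split: "M = image_mset l (mset_set {1..k}) + filter_mset (\<lambda>z. \<not> z \<noteq> 0) M"
    using multiset_partition[of M "\<lambda>z. z \<noteq> 0"] ev unfolding M_def by simp
  have "n = size M" using M as(2) by simp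
  also have "\<dots> = k + size (filter_mset (\<lambda>z. \<not> z \<noteq> 0) M)"
    by (subst M_split) simp
  finally have n: "n = k + size (filter_mset (\<lambda>z. \<not> z \<noteq> 0) M)" .
  have zeros: "filter_mset (\<lambda>z. \<not> z \<noteq> 0) M = replicate_mset (n - k) 0"
  proof -
    have "filter_mset (\<lambda>z. \<not> z \<noteq> 0) M = replicate_mset (count M 0) 0"
      using filter_eq_replicate_mset[of 0 M] by (simp add: eq_commute)
    then show ?thesis using n by simp
  qed
  define es where "es = map l [1..<Suc k] @ replicate (n - k) 0"
  have "mset es = M"
    using M_split zeros unfolding es_def by (simp add: atLeastLessThanSuc_atLeastAtMost del: upt_Suc)
  then have "mset (map (\<lambda>e. [:- e, 1:]) es) = mset (map (\<lambda>e. [:- e, 1:]) as)"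
    using M by (simp only: mset_map)
  then have "char_poly A = (\<Prod>e\<leftarrow>es. [:- e, 1:])"
    unfolding as(1) by (metis prod_mset_prod_list)
  from normal_spectral_decomposition[OF A normal this] obtain U
    where U: "unitary_mat n U" "A = U * mat_diag n (\<lambda>i. es ! i) * mat_adjoint U" by blast
  have "mat_diag n (\<lambda>i. es ! i) = mat_diag n (zero_padded k l)"
    by (rule mat_diag_cong) (auto simp: es_def zero_padded_def nth_append simp del: upt_Suc)
  then show ?thesis using U by auto
qed

lemma proots_char_poly_mat_diag:
  "proots (char_poly (mat_diag n d)) = image_mset d (mset_set {..<n})" for d :: "nat \<Rightarrow> complex"
proof -
  have "upper_triangular (mat_diag n d)" by (auto simp: mat_diag_def)
  then have "char_poly (mat_diag n d) = (\<Prod>a\<leftarrow>diag_mat (mat_diag n d). [:- a, 1:])"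
    by (rule char_poly_upper_triangular[OF mat_diag_dim])
  moreover have "diag_mat (mat_diag n d) = map d [0..<n]"
    by (simp add: diag_mat_def mat_diag_def)
  ultimately have "proots (char_poly (mat_diag n d)) = mset (map d [0..<n])"
    by (simp only: proots_prod_linear_factors)
  then show ?thesis by (simp add: lessThan_atLeast0)
qed

text \<open>An independent set of columns does not contain the zero vector.\<close>

lemma rank_mat_diag_le:
  fixes d :: "nat \<Rightarrow> complex"
  shows "vec_space.rank n (mat_diag n d) \<le> card {i. i < n \<and> d i \<noteq> 0}"
proof -
  interpret vec_space "TYPE(complex)" n .
  let ?A = "mat_diag n d" and ?I = "{i. i < n \<and> d i \<noteq> 0}"
  have "lin_indpt {}" by (rule finite_lin_indpt2) auto
  then obtain S where S: "maximal S (\<lambda>T. T \<subseteq> set (cols ?A) \<and> lin_indpt T)"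
    using maximal_exists_superset[of "set (cols ?A)" "\<lambda>T. T \<subseteq> set (cols ?A) \<and> lin_indpt T" "{}"]
    by auto
  then have S': "S \<subseteq> set (cols ?A)" "lin_indpt S" unfolding maximal_def by auto
  have "0\<^sub>v n \<notin> S"
  proof
    assume "0\<^sub>v n \<in> S"
    moreover have "(UNIV :: complex set) \<noteq> {0}" by (metis UNIV_I one_neq_zero singletonD)
    ultimately show False using S'(2) zero_lin_dep by blast
  qed
  moreover have "col ?A i = 0\<^sub>v n" if "i < n" "d i = 0" for i
    using that by (intro eq_vecI) (auto simp: mat_diag_def)
  moreover have "set (cols ?A) = col ?A ` {..<n}"
    unfolding cols_def using carrier_matD[OF mat_diag_dim, of n d]
    by (simp add: lessThan_atLeast0)
  ultimately have "S \<subseteq> col ?A ` ?I"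
    using S'(1) by (smt (verit) image_iff lessThan_iff mem_Collect_eq subset_iff)
  then have "card S \<le> card ?I" by (intro surj_card_le) auto
  then show ?thesis using rank_card_indpt[OF mat_diag_dim S] by simp
qed

text \<open>For the lower bound, fill the zeros on the diagonal by ones. The sum has full rank, and the rank of
  the summand that was added is at most the number of zeros.\<close>

lemma rank_mat_diag:
  fixes d :: "nat \<Rightarrow> complex"
  shows "vec_space.rank n (mat_diag n d) = card {i. i < n \<and> d i \<noteq> 0}"
proof -
  interpret vec_space "TYPE(complex)" n .
  let ?e = "\<lambda>i. if d i = 0 then 1 else 0 :: complex"
  let ?f = "\<lambda>i. if d i = 0 then 1 else d i"
  have sum: "mat_diag n d + mat_diag n ?e = mat_diag n ?f"
    by (intro eq_matI) (auto simp: mat_diag_def)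
  have "det (mat_diag n ?f) = prod_list (diag_mat (mat_diag n ?f))"
    by (rule det_upper_triangular[of _ n]) (auto simp: mat_diag_def)
  also have "\<dots> \<noteq> 0" by (auto simp: diag_mat_def mat_diag_def prod_list_zero_iff)
  finally have "rank (mat_diag n ?f) = n" by (intro low_rank_det_zero mat_diag_dim)
  then have "n \<le> rank (mat_diag n d) + rank (mat_diag n ?e)"
    using rank_subadditive[OF mat_diag_dim mat_diag_dim, of d ?e] sum by simp
  also have "rank (mat_diag n ?e) \<le> card {i. i < n \<and> d i = 0}"
  proof -
    have "{i. i < n \<and> ?e i \<noteq> 0} = {i. i < n \<and> d i = 0}" by auto
    then show ?thesis using rank_mat_diag_le[of n ?e] by simp
  qed
  finally have "n \<le> rank (mat_diag n d) + card {i. i < n \<and> d i = 0}" by simp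
  moreover have "card {i. i < n \<and> d i = 0} + card {i. i < n \<and> d i \<noteq> 0} = n"
  proof -
    have "card {..<n} = card ({i. i < n \<and> d i = 0} \<union> {i. i < n \<and> d i \<noteq> 0})"
      by (rule arg_cong[of _ _ card]) auto
    also have "\<dots> = card {i. i < n \<and> d i = 0} + card {i. i < n \<and> d i \<noteq> 0}"
      by (rule card_Un_disjoint) auto
    finally show ?thesis by simp
  qed
  ultimately show ?thesis using rank_mat_diag_le[of n d] by linarith
qed

lemma mat_diag_in_normal_mats_with:
  assumes "filter_mset (\<lambda>z. z \<noteq> 0) (image_mset d (mset_set {..<n})) = image_mset l (mset_set {1..k})"
  shows "mat_diag n d \<in> normal_mats_with n k l"
proof -
  have "k = size (filter_mset (\<lambda>z. z \<noteq> 0) (image_mset d (mset_set {..<n})))" by (simp add: assms)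
  also have "\<dots> = card {i. i < n \<and> d i \<noteq> 0}"
    by (simp add: filter_mset_image_mset filter_mset_mset_set Collect_conj_eq lessThan_def)
  finally have "vec_space.rank n (mat_diag n d) = k" by (simp add: rank_mat_diag)
  moreover have "normal_mat (mat_diag n d)"
    using carrier_matD[OF mat_diag_dim, of n d] by (simp add: normal_mat_def mult.commute)
  ultimately show ?thesis
    using assms by (simp add: normal_mats_with_def lists_nonzero_eigenvalues_def proots_char_poly_mat_diag)
qed

section \<open>The optimal coefficient\<close>

text \<open>An arrangement of \<open>r\<close> out of \<open>n\<close> elements is the beginning of a permutation; this is how the
  arrangements in the coefficient and the permutations in Birkhoff's theorem are related.\<close>

lemma inj_on_lessThan_extend:
  fixes f :: "nat \<Rightarrow> nat"
  assumes "r \<le> n" "inj_on f {..<r}" "f ` {..<r} \<subseteq> {..<n}"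
  shows "\<exists>p. bij_betw p {..<n} {..<n} \<and> (\<forall>i<r. p i = f i)"
proof -
  have "card ({..<n} - {..<r}) = card ({..<n} - f ` {..<r})"
    using assms by (simp add: card_Diff_subset card_image)
  then obtain g where g: "bij_betw g ({..<n} - {..<r}) ({..<n} - f ` {..<r})"
    using finite_same_card_bij[of "{..<n} - {..<r}" "{..<n} - f ` {..<r}"] by auto
  define p where "p = (\<lambda>i. if i < r then f i else g i)"
  have "bij_betw p {..<r} (f ` {..<r})"
    using assms(2) by (auto simp: p_def bij_betw_def inj_on_def)
  moreover have "bij_betw p ({..<n} - {..<r}) ({..<n} - f ` {..<r})"
    using g by (subst bij_betw_cong[of _ p g]) (auto simp: p_def)
  ultimately have "bij_betw p ({..<r} \<union> ({..<n} - {..<r})) (f ` {..<r} \<union> ({..<n} - f ` {..<r}))"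
    by (rule bij_betw_combine) auto
  moreover have "{..<r} \<union> ({..<n} - {..<r}) = {..<n}" using assms(1) by auto
  moreover have "f ` {..<r} \<union> ({..<n} - f ` {..<r}) = {..<n}" using assms(3) by auto
  ultimately show ?thesis by (intro exI[of _ p]) (auto simp: p_def)
qed

lemma sum_from_1_eq_sum_lessThan: "(\<Sum>j=1..r. f j) = (\<Sum>i<r. f (Suc i))"
  using sum.shift_bounds_cl_Suc_ivl[of f 0 "r"] by (simp add: sum.atLeast1_atMost_eq)

text \<open>Expanding the squares gives the denominator of the quotient in the coefficient. Only the values of
  the permutation at the first \<open>r\<close> indices enter the cross terms, since the remaining eigenvalues of the first
  matrix are zero.\<close>

lemma assignment_cost:
  assumes "r \<le> n" and p: "bij_betw p {..<n} {..<n}" and \<sigma>: "\<forall>i<r. \<sigma> (Suc i) = Suc (p i)"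
  shows "(\<Sum>i<n. (cmod (zero_padded r lam i - lamh (Suc (p i))))\<^sup>2)
    = F_hat r n lam lamh - 2 * (\<Sum>j=1..r. Re (lamh (\<sigma> j) * cnj (lam j)))"
proof -
  let ?z = "zero_padded r lam"
  have expand: "(cmod (a - b))\<^sup>2 = (cmod a)\<^sup>2 + (cmod b)\<^sup>2 - 2 * Re (b * cnj a)" for a b :: complex
    unfolding cmod_power2 by (simp add: power2_eq_square algebra_simps)
  have restrict: "(\<Sum>i<n. g i) = (\<Sum>i<r. g i)" if "\<And>i. r \<le> i \<Longrightarrow> g i = 0" for g :: "nat \<Rightarrow> real"
    using that assms(1) by (intro sum.mono_neutral_right) auto
  have "(\<Sum>i<n. (cmod (?z i))\<^sup>2) = (\<Sum>j=1..r. (cmod (lam j))\<^sup>2)"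
    unfolding sum_from_1_eq_sum_lessThan by (subst restrict) (auto simp: zero_padded_def)
  moreover have "(\<Sum>i<n. (cmod (lamh (Suc (p i))))\<^sup>2) = (\<Sum>j=1..n. (cmod (lamh j))\<^sup>2)"
    unfolding sum_from_1_eq_sum_lessThan using sum.reindex_bij_betw[OF p, of "\<lambda>i. (cmod (lamh (Suc i)))\<^sup>2"] .
  moreover have "(\<Sum>i<n. Re (lamh (Suc (p i)) * cnj (?z i))) = (\<Sum>j=1..r. Re (lamh (\<sigma> j) * cnj (lam j)))"
    unfolding sum_from_1_eq_sum_lessThan by (subst restrict) (auto simp: zero_padded_def \<sigma> intro!: sum.cong)
  ultimately show ?thesis
    unfolding expand F_hat_def
    by (simp only: sum.distrib sum_subtractf sum_distrib_left[symmetric])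
qed

text \<open>The numerator is the denominator for the sequences of absolute values.\<close>

lemma assignment_cost_abs:
  assumes "r \<le> n" "bij_betw p {..<n} {..<n}" "\<forall>i<r. \<sigma> (Suc i) = Suc (p i)"
  shows "(\<Sum>i<n. (cmod (complex_of_real (cmod (zero_padded r lam i))
      - complex_of_real (cmod (lamh (Suc (p i))))))\<^sup>2)
    = F_hat r n lam lamh - 2 * (\<Sum>j=1..r. cmod (lamh (\<sigma> j)) * cmod (lam j))"
proof -
  have pad: "complex_of_real (cmod (zero_padded r lam i))
      = zero_padded r (\<lambda>j. complex_of_real (cmod (lam j))) i" for i
    by (simp add: zero_padded_def)
  show ?thesis
    unfolding pad
    using assignment_cost[OF assms, of "\<lambda>j. complex_of_real (cmod (lam j))" "\<lambda>j. complex_of_real (cmod (lamh j))"]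
    by (simp add: F_hat_def)
qed

lemma norm_diff_norms_le: "(cmod (complex_of_real (cmod a) - complex_of_real (cmod b)))\<^sup>2 \<le> (cmod (a - b))\<^sup>2"
  by (metis abs_norm_cancel abs_le_square_iff norm_of_real norm_triangle_ineq3 of_real_diff)

definition abs_ratio :: "nat \<Rightarrow> nat \<Rightarrow> (nat \<Rightarrow> complex) \<Rightarrow> (nat \<Rightarrow> complex) \<Rightarrow> (nat \<Rightarrow> nat) \<Rightarrow> real" where
  "abs_ratio r n lam lamh \<sigma> =
     (F_hat r n lam lamh - 2 * (\<Sum>j=1..r. cmod (lamh (\<sigma> j)) * cmod (lam j))) /
     (F_hat r n lam lamh - 2 * (\<Sum>j=1..r. Re (lamh (\<sigma> j) * cnj (lam j))))"

lemma finite_arrangements: "finite (arrangements r n)"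
  unfolding arrangements_def
  by (rule finite_subset[of _ "{1..r} \<rightarrow>\<^sub>E {1..n}"]) (auto intro: finite_PiE)

lemma permutation_arrangement:
  assumes "r \<le> n" "bij_betw p {..<n} {..<n}"
  shows "(\<lambda>j\<in>{1..r}. Suc (p (j - 1))) \<in> arrangements r n"
proof -
  have inj: "inj_on p {..<n}" and img: "p ` {..<n} = {..<n}" using assms(2) by (auto simp: bij_betw_def)
  have "Suc (p (j - 1)) \<in> {1..n}" if "j \<in> {1..r}" for j
  proof -
    have "p (j - 1) \<in> {..<n}" using img that assms(1) by auto
    then show ?thesis by auto
  qed
  moreover have "inj_on (\<lambda>j\<in>{1..r}. Suc (p (j - 1))) {1..r}"
  proof (rule inj_onI)
    fix x y assume xy: "x \<in> {1..r}" "y \<in> {1..r}"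
      "(\<lambda>j\<in>{1..r}. Suc (p (j - 1))) x = (\<lambda>j\<in>{1..r}. Suc (p (j - 1))) y"
    then have "p (x - 1) = p (y - 1)" by simp
    then have "x - 1 = y - 1" by (rule inj_onD[OF inj]) (use xy(1,2) assms(1) in auto)
    then show "x = y" using xy(1,2) by auto
  qed
  ultimately show ?thesis unfolding arrangements_def by auto
qed

lemma arrangement_permutation:
  assumes "r \<le> n" "\<sigma> \<in> arrangements r n"
  shows "\<exists>p. bij_betw p {..<n} {..<n} \<and> (\<forall>i<r. \<sigma> (Suc i) = Suc (p i))"
proof -
  have \<sigma>: "\<And>j. j \<in> {1..r} \<Longrightarrow> \<sigma> j \<in> {1..n}" "inj_on \<sigma> {1..r}"
    using assms(2) by (auto simp: arrangements_def)
  have S: "\<sigma> (Suc i) = Suc (\<sigma> (Suc i) - 1)" "\<sigma> (Suc i) - 1 < n" if "i < r" for i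
    using \<sigma>(1)[of "Suc i"] that by auto
  have "inj_on (\<lambda>i. \<sigma> (Suc i) - 1) {..<r}"
  proof (rule inj_onI)
    fix x y assume xy: "x \<in> {..<r}" "y \<in> {..<r}" "\<sigma> (Suc x) - 1 = \<sigma> (Suc y) - 1"
    then have "\<sigma> (Suc x) = \<sigma> (Suc y)" using S(1)[of x] S(1)[of y] by simp
    then have "Suc x = Suc y" by (rule inj_onD[OF \<sigma>(2)]) (use xy(1,2) in auto)
    then show "x = y" by simp
  qed
  then obtain p where "bij_betw p {..<n} {..<n}" "\<forall>i<r. p i = \<sigma> (Suc i) - 1"
    using inj_on_lessThan_extend[OF assms(1), of "\<lambda>i. \<sigma> (Suc i) - 1"] S(2) by (auto simp: image_subset_iff)
  then show ?thesis using S(1) by metis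
qed

lemma abs_ratio_permutation:
  assumes "r \<le> n" "bij_betw p {..<n} {..<n}" "\<forall>i<r. \<sigma> (Suc i) = Suc (p i)"
  shows "abs_ratio r n lam lamh \<sigma>
    = (\<Sum>i<n. (cmod (complex_of_real (cmod (zero_padded r lam i))
        - complex_of_real (cmod (lamh (Suc (p i))))))\<^sup>2)
      / (\<Sum>i<n. (cmod (zero_padded r lam i - lamh (Suc (p i))))\<^sup>2)"
  unfolding abs_ratio_def assignment_cost[where lam = lam and lamh = lamh, OF assms]
    assignment_cost_abs[where lam = lam and lamh = lamh, OF assms] ..

lemma abs_coeff_Max:
  assumes "r \<le> n"
  shows "0 \<le> abs_coeff r n lam lamh"
    and "(abs_coeff r n lam lamh)\<^sup>2 = Max (abs_ratio r n lam lamh ` arrangements r n)"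
proof -
  define \<sigma> where "\<sigma> = (\<lambda>j\<in>{1..r}. Suc (j - 1))"
  have id: "bij_betw (\<lambda>i. i) {..<n} {..<n}" by (simp add: bij_betw_def inj_on_def)
  have \<sigma>: "\<sigma> \<in> arrangements r n" unfolding \<sigma>_def by (rule permutation_arrangement[OF assms id])
  have "0 \<le> abs_ratio r n lam lamh \<sigma>"
    by (subst abs_ratio_permutation[OF assms id]) (auto simp: \<sigma>_def intro!: divide_nonneg_nonneg sum_nonneg)
  also have "\<dots> \<le> Max (abs_ratio r n lam lamh ` arrangements r n)"
    using finite_arrangements \<sigma> by (intro Max_ge) auto
  finally have M: "0 \<le> Max (abs_ratio r n lam lamh ` arrangements r n)" .
  have eq: "abs_coeff r n lam lamh = sqrt (Max (abs_ratio r n lam lamh ` arrangements r n))"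
    unfolding abs_coeff_def abs_ratio_def[abs_def] ..
  show "0 \<le> abs_coeff r n lam lamh"
    and "(abs_coeff r n lam lamh)\<^sup>2 = Max (abs_ratio r n lam lamh ` arrangements r n)"
    unfolding eq using M by simp_all
qed

text \<open>The case of a vanishing denominator needs no exception: the numerator never exceeds the
  denominator, so it vanishes too.\<close>

lemma abs_coeff_bounds_permutation:
  assumes "r \<le> n" and p: "bij_betw p {..<n} {..<n}"
  shows "(\<Sum>i<n. (cmod (complex_of_real (cmod (zero_padded r lam i))
        - complex_of_real (cmod (lamh (Suc (p i))))))\<^sup>2)
      \<le> (abs_coeff r n lam lamh)\<^sup>2 * (\<Sum>i<n. (cmod (zero_padded r lam i - lamh (Suc (p i))))\<^sup>2)"
    (is "?N \<le> _ * ?D")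
proof -
  define \<sigma> where "\<sigma> = (\<lambda>j\<in>{1..r}. Suc (p (j - 1)))"
  have \<sigma>: "\<sigma> \<in> arrangements r n" unfolding \<sigma>_def by (rule permutation_arrangement[OF assms])
  have \<sigma>p: "\<forall>i<r. \<sigma> (Suc i) = Suc (p i)" by (simp add: \<sigma>_def)
  have ND: "?N \<le> ?D" by (intro sum_mono norm_diff_norms_le)
  have N0: "0 \<le> ?N" by (intro sum_nonneg) simp
  have "?N / ?D \<le> (abs_coeff r n lam lamh)\<^sup>2"
    unfolding abs_ratio_permutation[where lam = lam and lamh = lamh, OF assms \<sigma>p, symmetric] abs_coeff_Max(2)[OF \<open>r \<le> n\<close>]
    using finite_arrangements \<sigma> by (intro Max_ge) auto
  moreover have "?D = 0 \<or> 0 < ?D" using ND N0 by linarith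
  ultimately show ?thesis
    using ND N0 by (auto simp: divide_le_eq)
qed

text \<open>A positive coefficient is not the value assigned to a quotient \<open>0 / 0\<close>, so at a maximising arrangement
  the denominator is positive and the quotient can be cleared.\<close>

lemma abs_coeff_attained:
  assumes "r \<le> n" "0 < abs_coeff r n lam lamh"
  shows "\<exists>p. bij_betw p {..<n} {..<n}
    \<and> 0 < (\<Sum>i<n. (cmod (zero_padded r lam i - lamh (Suc (p i))))\<^sup>2)
    \<and> (\<Sum>i<n. (cmod (complex_of_real (cmod (zero_padded r lam i))
        - complex_of_real (cmod (lamh (Suc (p i))))))\<^sup>2)
      = (abs_coeff r n lam lamh)\<^sup>2 * (\<Sum>i<n. (cmod (zero_padded r lam i - lamh (Suc (p i))))\<^sup>2)"
proof -
  have "bij_betw (\<lambda>i. i) {..<n} {..<n}" by (simp add: bij_betw_def inj_on_def)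
  then have "arrangements r n \<noteq> {}" using permutation_arrangement[OF assms(1)] by blast
  then have "Max (abs_ratio r n lam lamh ` arrangements r n) \<in> abs_ratio r n lam lamh ` arrangements r n"
    using finite_arrangements by (intro Max_in) auto
  then obtain \<sigma> where \<sigma>: "\<sigma> \<in> arrangements r n" and
    sq: "(abs_coeff r n lam lamh)\<^sup>2 = abs_ratio r n lam lamh \<sigma>"
    unfolding abs_coeff_Max(2)[OF assms(1), symmetric] by blast
  obtain p where p: "bij_betw p {..<n} {..<n}" "\<forall>i<r. \<sigma> (Suc i) = Suc (p i)"
    using arrangement_permutation[OF assms(1) \<sigma>] by blast
  let ?N = "\<Sum>i<n. (cmod (complex_of_real (cmod (zero_padded r lam i))
        - complex_of_real (cmod (lamh (Suc (p i))))))\<^sup>2"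
  let ?D = "\<Sum>i<n. (cmod (zero_padded r lam i - lamh (Suc (p i))))\<^sup>2"
  have ratio: "(abs_coeff r n lam lamh)\<^sup>2 = ?N / ?D"
    unfolding sq by (rule abs_ratio_permutation[OF assms(1) p])
  have "?D \<noteq> 0"
  proof
    assume "?D = 0"
    then have "(abs_coeff r n lam lamh)\<^sup>2 = 0" unfolding ratio by simp
    then show False using assms(2) by simp
  qed
  moreover have "0 \<le> ?D" by (intro sum_nonneg) simp
  ultimately have D: "0 < ?D" by simp
  then have "?N = (abs_coeff r n lam lamh)\<^sup>2 * ?D" unfolding ratio by simp
  then show ?thesis using p(1) D by blast
qed

lemma frobenius_norm_diff_mat_diag:
  "(frobenius_norm (mat_diag n a - mat_diag n b))\<^sup>2 = (\<Sum>i<n. (cmod (a i - b i))\<^sup>2)"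
proof -
  have "(frobenius_norm (mat_diag n a - mat_diag n b))\<^sup>2
      = (\<Sum>i<n. \<Sum>j<n. (cmod ((mat_diag n a - mat_diag n b) $$ (i, j)))\<^sup>2)"
    by (rule frobenius_norm_sq) (rule minus_carrier_mat[OF mat_diag_dim])
  also have "\<dots> = (\<Sum>i<n. \<Sum>j<n. if j = i then (cmod (a i - b i))\<^sup>2 else 0)"
    by (intro sum.cong refl) (auto simp: mat_diag_def)
  finally show ?thesis by simp
qed

lemma mat_abs_mat_diag: "mat_abs (mat_diag n d) = mat_diag n (\<lambda>i. complex_of_real (cmod (d i)))"
proof -
  have one: "1\<^sub>m n * mat_diag n f * mat_adjoint (1\<^sub>m n) = mat_diag n f" for f :: "nat \<Rightarrow> complex"
  proof -
    have "mat_adjoint (1\<^sub>m n :: complex mat) = 1\<^sub>m n" by (rule eq_matI) auto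
    then show ?thesis by (simp add: left_mult_one_mat[of _ n n] right_mult_one_mat[of _ n n])
  qed
  show ?thesis using mat_abs_diagonalised[OF unitary_mat_one, of n d] unfolding one .
qed

theorem theorem1p25:
  fixes n r :: nat and lam lamh :: "nat \<Rightarrow> complex"
  assumes "1 \<le> r" and "r \<le> n"
    and "\<forall>j\<in>{1..r}. lam j \<noteq> 0" and "\<forall>j\<in>{1..n}. lamh j \<noteq> 0"
  shows "(\<forall>A \<in> normal_mats_with n r lam. \<forall>B \<in> normal_mats_with n n lamh.
            frobenius_norm (mat_abs A - mat_abs B)
              \<le> abs_coeff r n lam lamh * frobenius_norm (A - B)) \<and>
         (\<forall>c::real. 0 \<le> c \<and> c < abs_coeff r n lam lamh \<longrightarrow>
            \<not> (\<forall>A \<in> normal_mats_with n r lam. \<forall>B \<in> normal_mats_with n n lamh.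
                 frobenius_norm (mat_abs A - mat_abs B) \<le> c * frobenius_norm (A - B)))"
proof (intro conjI ballI allI impI notI)
  let ?K = "abs_coeff r n lam lamh"
  fix A B assume A: "A \<in> normal_mats_with n r lam" and B: "B \<in> normal_mats_with n n lamh"
  let ?a = "zero_padded r lam" and ?b = "zero_padded n lamh"
  obtain U where U: "unitary_mat n U" "A = U * mat_diag n ?a * mat_adjoint U"
    using normal_mats_with_diagonalised[OF A] by blast
  obtain V where V: "unitary_mat n V" "B = V * mat_diag n ?b * mat_adjoint V"
    using normal_mats_with_diagonalised[OF B] by blast
  define W where "W = mat_adjoint U * V"
  have W: "unitary_mat n W"
    unfolding W_def by (rule unitary_mat_mult[OF unitary_mat_adjoint[OF U(1)] V(1)])
  let ?N = "\<lambda>i j. (cmod (complex_of_real (cmod (?a i)) - complex_of_real (cmod (?b j))))\<^sup>2"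
  let ?D = "\<lambda>i j. (cmod (?a i - ?b j))\<^sup>2"
  let ?S = "\<lambda>i j. (cmod (W $$ (i, j)))\<^sup>2"
  have b: "?b i = lamh (Suc i)" if "i < n" for i using that by (simp add: zero_padded_def)
  have "0 \<le> (\<Sum>i<n. \<Sum>j<n. (?K\<^sup>2 * ?D i j - ?N i j) * ?S i j)"
  proof (rule doubly_stochastic_functional_nonneg[where t = 1])
    fix p assume p: "bij_betw p {..<n} {..<n}"
    have "?b (p i) = lamh (Suc (p i))" if "i < n" for i
      using bij_betwE[OF p] that by (intro b) auto
    then have "(\<Sum>i<n. ?N i (p i)) \<le> ?K\<^sup>2 * (\<Sum>i<n. ?D i (p i))"
      using abs_coeff_bounds_permutation[OF \<open>r \<le> n\<close> p, of lam lamh] by simp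
    then show "0 \<le> (\<Sum>i<n. ?K\<^sup>2 * ?D i (p i) - ?N i (p i))"
      by (simp add: sum_subtractf sum_distrib_left)
  qed (use unitary_mat_row_sum[OF W] unitary_mat_col_sum[OF W] in auto)
  then have "(\<Sum>i<n. \<Sum>j<n. ?N i j * ?S i j) \<le> ?K\<^sup>2 * (\<Sum>i<n. \<Sum>j<n. ?D i j * ?S i j)"
    by (simp add: sum_subtractf sum_distrib_left left_diff_distrib mult.assoc)
  then have "(frobenius_norm (mat_abs A - mat_abs B))\<^sup>2 \<le> (?K * frobenius_norm (A - B))\<^sup>2"
    unfolding U(2) V(2) mat_abs_diagonalised[OF U(1)] mat_abs_diagonalised[OF V(1)] power_mult_distrib
      frobenius_norm_diff_diagonalised[OF U(1) V(1)] W_def .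
  then show "frobenius_norm (mat_abs A - mat_abs B) \<le> ?K * frobenius_norm (A - B)"
    by (rule power2_le_imp_le) (use abs_coeff_Max(1)[OF \<open>r \<le> n\<close>] in simp)
next
  let ?K = "abs_coeff r n lam lamh"
  fix c :: real
  assume c: "0 \<le> c \<and> c < ?K"
    and bound: "\<forall>A \<in> normal_mats_with n r lam. \<forall>B \<in> normal_mats_with n n lamh.
                 frobenius_norm (mat_abs A - mat_abs B) \<le> c * frobenius_norm (A - B)"
  obtain p where p: "bij_betw p {..<n} {..<n}"
    and D0: "0 < (\<Sum>i<n. (cmod (zero_padded r lam i - lamh (Suc (p i))))\<^sup>2)"
    and ND: "(\<Sum>i<n. (cmod (complex_of_real (cmod (zero_padded r lam i))
        - complex_of_real (cmod (lamh (Suc (p i))))))\<^sup>2)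
      = ?K\<^sup>2 * (\<Sum>i<n. (cmod (zero_padded r lam i - lamh (Suc (p i))))\<^sup>2)"
    using abs_coeff_attained[OF \<open>r \<le> n\<close>, of lam lamh] c by auto
  define A where "A = mat_diag n (zero_padded r lam)"
  define B where "B = mat_diag n (\<lambda>i. lamh (Suc (p i)))"
  have shift: "mset_set {1..m} = image_mset Suc (mset_set {..<m})" for m
    using image_mset_mset_set[of Suc "{..<m}"] by (simp add: image_Suc_lessThan)
  have "A \<in> normal_mats_with n r lam"
    unfolding A_def
  proof (rule mat_diag_in_normal_mats_with)
    have "filter_mset (\<lambda>z. z \<noteq> 0) (image_mset (zero_padded r lam) (mset_set {..<n}))
        = image_mset (zero_padded r lam) (mset_set {i \<in> {..<n}. zero_padded r lam i \<noteq> 0})"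
      by (simp add: filter_mset_image_mset filter_mset_mset_set)
    also have "{i \<in> {..<n}. zero_padded r lam i \<noteq> 0} = {..<r}"
      using assms(2,3) by (auto simp: zero_padded_def)
    also have "image_mset (zero_padded r lam) (mset_set {..<r}) = image_mset lam (mset_set {1..r})"
      unfolding shift multiset.map_comp by (intro image_mset_cong) (simp add: zero_padded_def)
    finally show "filter_mset (\<lambda>z. z \<noteq> 0) (image_mset (zero_padded r lam) (mset_set {..<n}))
        = image_mset lam (mset_set {1..r})" .
  qed
  moreover have "B \<in> normal_mats_with n n lamh"
    unfolding B_def
  proof (rule mat_diag_in_normal_mats_with)
    have perm: "image_mset p (mset_set {..<n}) = mset_set {..<n}"
      using p image_mset_mset_set[of p "{..<n}"] unfolding bij_betw_def by simp
    have "image_mset (\<lambda>i. lamh (Suc (p i))) (mset_set {..<n})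
        = image_mset (\<lambda>i. lamh (Suc i)) (image_mset p (mset_set {..<n}))"
      unfolding multiset.map_comp comp_def ..
    then have eq: "image_mset (\<lambda>i. lamh (Suc (p i))) (mset_set {..<n}) = image_mset lamh (mset_set {1..n})"
      unfolding perm shift multiset.map_comp comp_def .
    show "filter_mset (\<lambda>z. z \<noteq> 0) (image_mset (\<lambda>i. lamh (Suc (p i))) (mset_set {..<n}))
        = image_mset lamh (mset_set {1..n})"
      unfolding eq using assms(4) by (auto simp: filter_mset_eq_conv)
  qed
  ultimately have "frobenius_norm (mat_abs A - mat_abs B) \<le> c * frobenius_norm (A - B)"
    using bound by blast
  from power_mono[OF this frobenius_norm_nonneg, of 2]
  have "(frobenius_norm (mat_abs A - mat_abs B))\<^sup>2 \<le> c\<^sup>2 * (frobenius_norm (A - B))\<^sup>2"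
    by (simp add: power_mult_distrib)
  then have "?K\<^sup>2 \<le> c\<^sup>2"
    using D0 unfolding A_def B_def mat_abs_mat_diag frobenius_norm_diff_mat_diag ND by simp
  moreover have "c\<^sup>2 < ?K\<^sup>2" using c by (intro power_strict_mono) auto
  ultimately show False by simp
qed

end
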